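(* Let $S$ be any strategy for escaping, i.e. a continuous path in the plane starting at the starting point $s$ (the same path, up to translation to $s$, being used regardless of the environment, since neither the environment nor its rotation about $s$ nor the position of $s$ is known) that eventually reaches the boundary of every environment containing $s$ in its interior. Then in the worst case $S$ attains a competitive factor of at least $3.313126$ against the certificate path: the supremum, over all environments $P$ containing $s$ in their interior, of the ratio of the length of $S$ from $s$ until its first point on $\partial P$ to the certificate length $\Pi_s$ of $P$ at $s$ is at least $3.313126$.
   Context: An environment is the closed bounded region $P\subset\mathbb{R}^2$ enclosed by a closed Jordan curve $\partial P$. For $s$ in the interior of $P$ and $x>0$, let $C_s(x)$ be the circle of radius $x$ centred at $s$. For $x$ such that $C_s(x)\cap\partial P\neq\emptyset$, let $\alpha_s(x)\in[0,2\pi]$ be the supremum of the angles of arcs of $C_s(x)$ contained in the interior of $P$ (and $0$ if there is none). The circular strategy for distance $x$ (move straight distance $x$ from $s$, then along $C_s(x)$ for angle $\alpha_s(x)$) meets $\partial P$ for every starting direction and has length $x(1+\alpha_s(x))$. The certificate length is $\Pi_s=\min_x x(1+\alpha_s(x))$ over all $x>0$ with $C_s(x)\cap\partial P\neq\emptyset$. *)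

theory Defs
  imports "HOL-Analysis.Analysis" "HOL-Library.Extended_Real"
begin

definition environment :: "complex set \<Rightarrow> bool" where
  "environment P \<longleftrightarrow> (\<exists>g. simple_path g \<and> pathfinish g = pathstart g \<and>
      P = path_image g \<union> inside (path_image g))"

definition curve_length :: "(real \<Rightarrow> complex) \<Rightarrow> real \<Rightarrow> real \<Rightarrow> ereal" where
  "curve_length f a b =
     (SUP ts \<in> {ts. sorted ts \<and> set ts \<subseteq> {a..b}}.
        ereal (\<Sum>i<length ts - 1. dist (f (ts ! i)) (f (ts ! Suc i))))"

definition arc_angle :: "complex set \<Rightarrow> complex \<Rightarrow> real \<Rightarrow> real" where
  "arc_angle P s x = Sup ({0} \<union> {phi. 0 \<le> phi \<and> phi \<le> 2 * pi \<and>
       (\<exists>a. \<forall>\<theta>\<in>{a..a + phi}. s + of_real x * cis \<theta> \<in> interior P)})"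

definition certificate_length :: "complex set \<Rightarrow> complex \<Rightarrow> real" where
  "certificate_length P s = Inf ((\<lambda>x. x * (1 + arc_angle P s x)) `
       {x. x > 0 \<and> sphere s x \<inter> frontier P \<noteq> {}})"

definition first_hit :: "(real \<Rightarrow> complex) \<Rightarrow> complex \<Rightarrow> complex set \<Rightarrow> real" where
  "first_hit S s P = Inf {t. 0 \<le> t \<and> s + S t \<in> frontier P}"

definition escape_strategy :: "(real \<Rightarrow> complex) \<Rightarrow> complex \<Rightarrow> bool" where
  "escape_strategy S s \<longleftrightarrow> continuous_on {0..} S \<and> S 0 = 0 \<and>
     (\<forall>P. environment P \<and> s \<in> interior P \<longrightarrow> (\<exists>t\<ge>0. s + S t \<in> frontier P))"

end

theory Submission
  imports Defs
begin

text \<open>Suppose that the strategy has competitive factor C = 3.313126, let L be its path length and M the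
  largest distance from s reached so far. Discs give L <= C M. Discs with a thin dent along a single
  ray, whose certificate is at most x (1 + 2 pi), give L <= C (1 + 2 pi) x as long as some direction
  has not been visited at depth x. Give a visit at depth u and length L the weight
  ln (C (1 + 2 pi) u / L): by the second bound the weights of the visits to any fixed direction add up
  to ln L up to a constant, so the integral over all directions grows like 2 pi ln L. On the other
  hand, a unit of length spent in a state (u, M, L) sweeps only a tangential part over u, and the
  potential K M / L - c(L / M) (1 - u / M) with K = 2.1 and c(r) = 2 r - 6.1 shows that the
  accumulated weight is at most 6.28 ln L up to a constant. As 6.28 < 2 pi, L would be bounded. The
  constant K is, up to rounding, the multiplier for which a logarithmic spiral is optimal among the
  paths with u = M; the second term of the potential charges for excursions with u < M, during which the sweep
  is cheaper.\<close>

section \<open>The potential inequality\<close>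

text \<open>After multiplication by \<open>h^6\<close> the polynomial is a combination of the
  products \<open>t^i * (h-t)^(6-i)\<close>, and the seven assumed quantities are exactly its
  coefficients (Bernstein form on \<open>[0, h]\<close>).\<close>

lemma sextic_nonneg:
  fixes t h :: real
  assumes t: "0 \<le> t" "t \<le> h"
    and "0 \<le> q0" "0 \<le> 6*q0 + q1*h" "0 \<le> 15*q0 + 5*q1*h + q2*h^2"
    "0 \<le> 20*q0 + 10*q1*h + 4*q2*h^2 + q3*h^3"
    "0 \<le> 15*q0 + 10*q1*h + 6*q2*h^2 + 3*q3*h^3 + q4*h^4"
    "0 \<le> 6*q0 + 5*q1*h + 4*q2*h^2 + 3*q3*h^3 + 2*q4*h^4 + q5*h^5"
    "0 \<le> q0 + q1*h + q2*h^2 + q3*h^3 + q4*h^4 + q5*h^5 + q6*h^6"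
  shows "0 \<le> q0 + q1*t + q2*t^2 + q3*t^3 + q4*t^4 + q5*t^5 + q6*t^6"
proof (cases "h = 0")
  case True
  then show ?thesis using assms by simp
next
  case False
  then have h: "h^6 > 0" using t by simp
  have N: "0 \<le> t^i * (h-t)^j" for i j using t by simp
  have "h^6 * (q0 + q1*t + q2*t^2 + q3*t^3 + q4*t^4 + q5*t^5 + q6*t^6) =
      q0 * (t^0 * (h-t)^6) + (6*q0 + q1*h) * (t^1 * (h-t)^5) + (15*q0 + 5*q1*h + q2*h^2) * (t^2 * (h-t)^4)
    + (20*q0 + 10*q1*h + 4*q2*h^2 + q3*h^3) * (t^3 * (h-t)^3)
    + (15*q0 + 10*q1*h + 6*q2*h^2 + 3*q3*h^3 + q4*h^4) * (t^4 * (h-t)^2)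
    + (6*q0 + 5*q1*h + 4*q2*h^2 + 3*q3*h^3 + 2*q4*h^4 + q5*h^5) * (t^5 * (h-t)^1)
    + (q0 + q1*h + q2*h^2 + q3*h^3 + q4*h^4 + q5*h^5 + q6*h^6) * (t^6 * (h-t)^0)"
    by algebra
  also have "\<dots> \<ge> 0"
    by (intro add_nonneg_nonneg assms(3-9)[THEN mult_nonneg_nonneg] N)
  finally show ?thesis using h by (simp add: zero_le_mult_iff)
qed

text \<open>The last seven conditions say that the difference of the two sides, a sextic in r, has nonnegative
  coefficients in the Bernstein basis of [lo, hi].\<close>

lemma radial_poly_nonneg:
  fixes r lo hi s \<alpha> \<beta> :: real
  assumes r: "lo \<le> r" "r \<le> hi"
  defines "a0 \<equiv> 2.1 * 2.1 :: real" and "a1 \<equiv> 2*2.1*6.278 :: real" and "a2 \<equiv> 6.278 * 6.278 + 2*2.1* s - \<alpha>^2"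
    and "a3 \<equiv> 2*6.278* s - 2*\<alpha>*\<beta>" and "a4 \<equiv> s^2 - \<beta>^2 - 6.1 * 6.1"
    and "h \<equiv> hi - lo"
  defines "q0 \<equiv> a0 + a1*lo + a2*lo^2 + a3*lo^3 + a4*lo^4 + 24.4*lo^5 - 4*lo^6"
    and "q1 \<equiv> a1 + 2*a2*lo + 3*a3*lo^2 + 4*a4*lo^3 + 5*24.4*lo^4 - 6*4*lo^5"
    and "q2 \<equiv> a2 + 3*a3*lo + 6*a4*lo^2 + 10*24.4*lo^3 - 15*4*lo^4"
    and "q3 \<equiv> a3 + 4*a4*lo + 10*24.4*lo^2 - 20*4*lo^3"
    and "q4 \<equiv> a4 + 5*24.4*lo - 15*4*lo^2"
    and "q5 \<equiv> 24.4 - 6*4*lo" and "q6 \<equiv> -4::real"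
  assumes "0 \<le> q0" "0 \<le> 6*q0 + q1*h" "0 \<le> 15*q0 + 5*q1*h + q2*h^2"
    "0 \<le> 20*q0 + 10*q1*h + 4*q2*h^2 + q3*h^3"
    "0 \<le> 15*q0 + 10*q1*h + 6*q2*h^2 + 3*q3*h^3 + q4*h^4"
    "0 \<le> 6*q0 + 5*q1*h + 4*q2*h^2 + 3*q3*h^3 + 2*q4*h^4 + q5*h^5"
    "0 \<le> q0 + q1*h + q2*h^2 + q3*h^3 + q4*h^4 + q5*h^5 + q6*h^6"
  shows "(\<alpha> * r + \<beta> * r^2)\<^sup>2 + (r * (r * (2 * r - 6.1)))\<^sup>2 \<le> (2.1 + 6.278 * r + s * r^2)\<^sup>2"
proof -
  \<comment> \<open>The \<open>q\<close> coefficients form the Taylor expansion at \<open>lo\<close>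
    of right side minus left side, that is, its expansion in powers of \<open>t\<close>.\<close>
  define t where "t = r - lo"
  have r': "r = lo + t" by (simp add: t_def)
  have "0 \<le> q0 + q1*t + q2*t^2 + q3*t^3 + q4*t^4 + q5*t^5 + q6*t^6"
    using assms by (intro sextic_nonneg[of t h]) (simp_all add: t_def)
  also have "\<dots> = (2.1 + 6.278 * r + s * r^2)\<^sup>2 - (\<alpha> * r + \<beta> * r^2)\<^sup>2 - (r * (r * (2 * r - 6.1)))\<^sup>2"
    unfolding q0_def q1_def q2_def q3_def q4_def q5_def q6_def a0_def a1_def a2_def a3_def a4_def r'
    by algebra
  finally show ?thesis by simp
qed

text \<open>This and the next five lemmas are the cases of \<open>sweep_bound\<close> at the end of
  a range of \<open>y\<close>, squared and with the denominators \<open>r^2\<close> cleared. The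
  numbers on the left come from the linear bounds in \<open>ln_full_turn_tangents\<close>; the
  factor \<open>1 - 0.195\<close> on the right is \<open>1 - y\<close>.\<close>

lemma polar_poly_small:
  fixes r :: real
  assumes "1 \<le> r" "r \<le> 3.3132"
  shows "((1.0005 * 8.878) * r + 0 * r\<^sup>2)\<^sup>2 + (r * (r * (2 * r - 6.1)))\<^sup>2 \<le> (2.1 + 6.278 * r + (2 * (1 - 0.195)) * r^2)\<^sup>2"
proof -
  \<comment> \<open>Nonnegative Bernstein coefficients are only sufficient for nonnegativity;
    shorter intervals make the test sharper.\<close>
  consider "1 \<le> r" "r \<le> 1.29" | "1.29 \<le> r" "r \<le> 1.58" | "1.58 \<le> r" "r \<le> 2.15" | "2.15 \<le> r" "r \<le> 3.3132" using assms by linarith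
  then show ?thesis
    by cases ((rule radial_poly_nonneg, assumption, assumption); simp add: power_divide)+
qed

text \<open>For large \<open>r\<close> the tangent through the origin suffices up to
  \<open>y = 0.5\<close>, so the middle tangent is needed only for \<open>r\<close> up to
  2.35.\<close>

lemma polar_poly_small_far:
  fixes r :: real
  assumes "2.35 \<le> r" "r \<le> 3.3132"
  shows "((1.0005 * 8.878) * r + 0 * r\<^sup>2)\<^sup>2 + (r * (r * (2 * r - 6.1)))\<^sup>2 \<le> (2.1 + 6.278 * r + (2 * (1 - 0.5)) * r^2)\<^sup>2"
  by (intro radial_poly_nonneg[where lo="2.35" and hi="3.3132"] assms) (simp_all add: power_divide)

lemma polar_poly_middle_lower:
  fixes r :: real
  assumes "1 \<le> r" "r \<le> 2.35"
  shows "((1.0005 * (100/14)) * r + (1.0005 * 0.2176 / 0.195) * r\<^sup>2)\<^sup>2 + (r * (r * (2 * r - 6.1)))\<^sup>2 \<le> (2.1 + 6.278 * r + (2 * (1 - 0.195)) * r^2)\<^sup>2"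
proof -
  consider "1 \<le> r" "r \<le> 1.67" | "1.67 \<le> r" "r \<le> 2.35" using assms by linarith
  then show ?thesis
    by cases ((rule radial_poly_nonneg, assumption, assumption); simp add: power_divide)+
qed

lemma polar_poly_middle_upper:
  fixes r :: real
  assumes "1 \<le> r" "r \<le> 2.35"
  shows "((1.0005 * (100/14)) * r + (1.0005 * 0.2176 / 0.5) * r\<^sup>2)\<^sup>2 + (r * (r * (2 * r - 6.1)))\<^sup>2 \<le> (2.1 + 6.278 * r + (2 * (1 - 0.5)) * r^2)\<^sup>2"
proof -
  consider "1 \<le> r" "r \<le> 1.67" | "1.67 \<le> r" "r \<le> 2.35" using assms by linarith
  then show ?thesis
    by cases ((rule radial_poly_nonneg, assumption, assumption); simp add: power_divide)+
qed

lemma polar_poly_large_lower: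
  fixes r :: real
  assumes "1 \<le> r" "r \<le> 3.3132"
  shows "((1.0005 * 3.3132) * r + (1.0005 * 0.9857 / 0.5) * r\<^sup>2)\<^sup>2 + (r * (r * (2 * r - 6.1)))\<^sup>2 \<le> (2.1 + 6.278 * r + (2 * (1 - 0.5)) * r^2)\<^sup>2"
  by (intro radial_poly_nonneg[where lo="1" and hi="3.3132"] assms) (simp_all add: power_divide)

lemma polar_poly_large_upper:
  fixes r :: real
  assumes "1 \<le> r" "r \<le> 3.3132"
  shows "((1.0005 * 3.3132) * r + (1.0005 * 0.9857 / 1) * r\<^sup>2)\<^sup>2 + (r * (r * (2 * r - 6.1)))\<^sup>2 \<le> (2.1 + 6.278 * r + (2 * (1 - 1)) * r^2)\<^sup>2"
  by (intro radial_poly_nonneg[where lo="1" and hi="3.3132"] assms) (simp_all add: power_divide)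

section \<open>Linear upper bounds for the logarithm\<close>

text \<open>For nonnegative \<open>x\<close> the partial sums of the exponential series lie below
  \<open>exp x\<close>, so a finite rational computation certifies a bound on a logarithm.\<close>

lemma ln_le_from_exp_series:
  fixes a x :: real
  assumes "0 < a" "0 \<le> x" "a \<le> (\<Sum>k<n. x ^ k / fact k)"
  shows "ln a \<le> x"
proof -
  have "(\<lambda>k. x ^ k / fact k) sums exp x"
    using exp_converges[of x] by (simp add: field_simps scaleR_conv_of_real)
  then have "(\<Sum>k<n. x ^ k / fact k) \<le> exp x"
    using assms(2) by (metis (no_types, lifting) sum_le_suminf sums_iff divide_nonneg_pos fact_gt_zero finite_lessThan zero_le_power)
  then have "ln a \<le> ln (exp x)"
    using assms by (subst ln_le_cancel_iff) auto
  then show ?thesis by simp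
qed

text \<open>The factor 3.3132 is slightly larger than 3.313126 and absorbs errors of the discretisation, as do
  the factors 1.0004 and 1.0005 below.\<close>

definition full_turn :: real where "full_turn = 3.3132 * (1 + 2 * pi)"

lemma full_turn_pos: "0 < full_turn"
  by (simp add: full_turn_def add_pos_pos)

lemma full_turn_le: "full_turn \<le> 24.1307"
  using pi_approx(2) by (simp add: full_turn_def)

lemma ln_le_tangent:
  fixes x z :: real
  assumes "0 < x" "0 < z"
  shows "ln x \<le> ln z + x / z - 1"
  using ln_le_minus_one[of "x / z"] assms by (simp add: ln_div)

text \<open>Concavity: these are, with constants rounded up, the tangents at
  \<open>v = 1 / 8.878\<close>, \<open>0.14\<close> and \<open>1 / 3.3132\<close>. The first passes
  through the origin, since \<open>full_turn / 8.878\<close> is about e; the third touches at the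
  smallest possible value of \<open>M / l\<close>.\<close>

lemma ln_full_turn_tangents:
  fixes v :: real
  assumes "0 < v"
  shows "ln (full_turn * v) \<le> 8.878 * v"
    and "ln (full_turn * v) \<le> 0.2176 + 100 / 14 * v"
    and "ln (full_turn * v) \<le> 0.9857 + 3.3132 * v"
proof -
  have t: "ln (full_turn * v) \<le> ln (full_turn * z) + v / z - 1" if "0 < z" for z
    using ln_le_tangent[of "full_turn * v" "full_turn * z"] assms that full_turn_pos by simp
  have "ln (full_turn / 8.878) \<le> 1"
    by (rule ln_le_from_exp_series[where n=10])
      (use full_turn_pos full_turn_le in \<open>auto simp: lessThan_nat_numeral fact_numeral\<close>)
  then show "ln (full_turn * v) \<le> 8.878 * v"
    using t[of "1 / 8.878"] by simp
  have "ln (full_turn * 0.14) \<le> 1.2176"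
    by (rule ln_le_from_exp_series[where n=10])
      (use full_turn_pos full_turn_le in \<open>auto simp: lessThan_nat_numeral fact_numeral power_divide\<close>)
  then show "ln (full_turn * v) \<le> 0.2176 + 100 / 14 * v"
    using t[of "0.14"] by simp
  have "ln (full_turn / 3.3132) \<le> 1.9857"
    by (rule ln_le_from_exp_series[where n=12])
      (use full_turn_pos full_turn_le in \<open>auto simp: lessThan_nat_numeral fact_numeral power_divide\<close>)
  then show "ln (full_turn * v) \<le> 0.9857 + 3.3132 * v"
    using t[of "1 / 3.3132"] by simp
qed

text \<open>The left-hand side is the square of a norm that is convex in y, the right-hand side that of an
  affine function, so the endpoints suffice.\<close>

lemma norm_chord_bound:
  fixes r y y0 y1 A B X :: real
  assumes y: "0 < y0" "y0 \<le> y" "y \<le> y1" and "0 \<le> A" "0 \<le> B" "0 < r"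
    and R: "0 \<le> K + p * r"  "y1 \<le> 1"
    and 0: "(A * r + B / y0 * r\<^sup>2)\<^sup>2 + X\<^sup>2 \<le> (K + p * r + 2 * (1 - y0) * r\<^sup>2)\<^sup>2"
    and 1: "(A * r + B / y1 * r\<^sup>2)\<^sup>2 + X\<^sup>2 \<le> (K + p * r + 2 * (1 - y1) * r\<^sup>2)\<^sup>2"
  shows "(A * r + B / y * r\<^sup>2)\<^sup>2 + X\<^sup>2 \<le> (K + p * r + 2 * (1 - y) * r\<^sup>2)\<^sup>2"
proof (cases "y0 = y1")
  case True
  then show ?thesis using assms by auto
next
  case False
  define t where "t = (y - y0) / (y1 - y0)"
  have t: "0 \<le> t" "t \<le> 1" using False y by (auto simp: t_def)
  have "t * (y1 - y0) = y - y0" using False by (simp add: t_def)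
  then have yt: "y = (1 - t) * y0 + t * y1" by (simp add: algebra_simps)
  define a where "a \<equiv> \<lambda>y. A * r + B / y * r\<^sup>2"
  define b where "b \<equiv> \<lambda>y. K + p * r + 2 * (1 - y) * r\<^sup>2"
  have b0: "0 \<le> b z" if "z \<le> 1" for z
    using R that \<open>0 < r\<close> by (simp add: b_def)
  have n: "cmod (Complex (a z) X) \<le> b z" if "(a z)\<^sup>2 + X\<^sup>2 \<le> (b z)\<^sup>2" "z \<le> 1" for z
    using that b0[of z] by (simp add: cmod_def real_le_lsqrt)
  \<comment> \<open>Convexity of the reciprocal; with denominators cleared it is the nonnegativity
    of \<open>t * (1 - t) * (y1 - y0)^2\<close>.\<close>
  have conv: "1 / y \<le> (1 - t) / y0 + t / y1"
  proof -
    have "0 \<le> t * (1 - t) * (y1 - y0)\<^sup>2" using t by simp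
    then have "y0 * y1 \<le> ((1 - t) * y1 + t * y0) * y"
      unfolding yt by (simp add: power2_eq_square algebra_simps)
    then show ?thesis using y by (simp add: field_simps)
  qed
  have "a y \<le> (1 - t) * a y0 + t * a y1"
  proof -
    have "B * r\<^sup>2 * (1 / y) \<le> B * r\<^sup>2 * ((1 - t) / y0 + t / y1)"
      using conv assms by (intro mult_left_mono) auto
    then show ?thesis by (simp add: a_def algebra_simps add_divide_distrib)
  qed
  moreover have "0 \<le> a y" using assms by (simp add: a_def)
  \<comment> \<open>The left side is read as the squared norm of the complex number with parts
    \<open>a y\<close> and \<open>X\<close>, so that the triangle inequality gives
    convexity.\<close>
  ultimately have "(a y)\<^sup>2 + X\<^sup>2 \<le> (cmod (Complex ((1 - t) * a y0 + t * a y1) X))\<^sup>2"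
    by (simp add: cmod_power2 power_mono)
  also have "Complex ((1 - t) * a y0 + t * a y1) X
      = of_real (1 - t) * Complex (a y0) X + of_real t * Complex (a y1) X"
    by (simp add: complex_eq_iff algebra_simps)
  also have "(cmod \<dots>)\<^sup>2 \<le> ((1 - t) * b y0 + t * b y1)\<^sup>2"
  proof (intro power_mono norm_triangle_le add_mono)
    show "cmod (of_real (1 - t) * Complex (a y0) X) \<le> (1 - t) * b y0"
      unfolding norm_mult norm_of_real using t n[of y0] 0 R(2) y
      by (intro mult_mono) (auto simp: a_def b_def)
    show "cmod (of_real t * Complex (a y1) X) \<le> t * b y1"
      unfolding norm_mult norm_of_real using t n[of y1] 1 R(2)
      by (intro mult_mono) (auto simp: a_def b_def)
  qed auto
  also have "(1 - t) * b y0 + t * b y1 = b y"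
    by (simp add: b_def yt algebra_simps)
  finally show ?thesis by (simp add: a_def b_def)
qed

text \<open>Here r = L / M and y = u / M, and g is M times the weight that is swept per unit of tangential
  length.\<close>

lemma sweep_bound:
  fixes r y :: real
  assumes r: "1 \<le> r" "r \<le> 3.3132" and y: "0 \<le> y" "y \<le> 1"
  defines "g \<equiv> 1.0005 * max 0 (ln (full_turn * y / r)) / y"
  shows "sqrt (g\<^sup>2 + (2 * r - 6.1)\<^sup>2) \<le> 6.278 / r + 2.1 / r\<^sup>2 + 2 * (1 - y)"
proof -
  define X where "X = r * (r * (2 * r - 6.1))"
  define R where "R = 2.1 + 6.278 * r + 2 * (1 - y) * r\<^sup>2"
  have R0: "R \<ge> 0" using r y by (simp add: R_def)
  have g0: "0 \<le> g" using y by (simp add: g_def)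
  \<comment> \<open>A linear bound \<open>B + A * v\<close> on the logarithm turns the claim into a
    rational inequality in \<open>r\<close> and \<open>y\<close>, where
    \<open>v = y / r\<close>.\<close>
  have key: "(r\<^sup>2 * g)\<^sup>2 + X\<^sup>2 \<le> R\<^sup>2"
    if "0 \<le> A" "0 \<le> B" "\<And>v. 0 < v \<Longrightarrow> ln (full_turn * v) \<le> B + A * v"
      and "(1.0005 * A * r + (1.0005 * B) / y * r\<^sup>2)\<^sup>2 + X\<^sup>2 \<le> R\<^sup>2" for A B
  proof -
    have "r\<^sup>2 * g \<le> 1.0005 * A * r + (1.0005 * B) / y * r\<^sup>2"
    \<comment> \<open>At \<open>y = 0\<close> division by zero yields \<open>g = 0\<close>, so the
      bound is trivial.\<close>
    proof (cases "y = 0")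
      case False
      have "max 0 (ln (full_turn * (y / r))) \<le> B + A * (y / r)"
        using that(3)[of "y / r"] r y False that(1,2) by simp
      then have "g \<le> 1.0005 * (B + A * (y / r)) / y"
        unfolding g_def using y False by (intro divide_right_mono mult_left_mono) auto
      then have "r\<^sup>2 * g \<le> r\<^sup>2 * (1.0005 * (B + A * (y / r)) / y)"
        by (intro mult_left_mono) auto
      also have "\<dots> = 1.0005 * A * r + (1.0005 * B) / y * r\<^sup>2"
        using False r by (simp add: field_simps power2_eq_square)
      finally show ?thesis .
    qed (use that r in \<open>simp add: g_def\<close>)
    then have "(r\<^sup>2 * g)\<^sup>2 \<le> (1.0005 * A * r + (1.0005 * B) / y * r\<^sup>2)\<^sup>2"
      using g0 by (intro power_mono) auto
    then show ?thesis using that(4) by simp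
  qed
  have R1: "(1.0005 * 8.878 * r)\<^sup>2 + X\<^sup>2 \<le> R\<^sup>2"
    if "y \<le> y0" "y0 \<le> 1" "(1.0005 * 8.878 * r + 0 * r\<^sup>2)\<^sup>2 + X\<^sup>2 \<le> (2.1 + 6.278 * r + (2 * (1 - y0)) * r\<^sup>2)\<^sup>2" for y0
  proof -
    have "2.1 + 6.278 * r + (2 * (1 - y0)) * r\<^sup>2 \<le> R"
      using that unfolding R_def by (intro add_left_mono mult_right_mono) auto
    then have "(2.1 + 6.278 * r + (2 * (1 - y0)) * r\<^sup>2)\<^sup>2 \<le> R\<^sup>2"
      using that r by (intro power_mono) auto
    then show ?thesis using that(3) by simp
  qed
  \<comment> \<open>In the first two regions the tangent through the origin is used: its bound on
    \<open>g\<close> has no term in \<open>1 / y\<close>. The flatter tangents serve the other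
    regions, where \<open>y\<close> stays away from 0.\<close>
  consider "y \<le> 0.195" | "y \<le> 0.5" "2.35 \<le> r" | "0.195 \<le> y" "y \<le> 0.5" "r \<le> 2.35" | "0.5 \<le> y"
    by linarith
  then have main: "(r\<^sup>2 * g)\<^sup>2 + X\<^sup>2 \<le> R\<^sup>2"
  proof cases
    case 1
    show ?thesis
      by (rule key[of "8.878" 0]) (use ln_full_turn_tangents(1) R1[OF 1] polar_poly_small[OF r] in \<open>simp_all add: X_def\<close>)
  next
    case 2
    show ?thesis
      by (rule key[of "8.878" 0]) (use ln_full_turn_tangents(1) R1[OF 2(1)] polar_poly_small_far[OF 2(2) r(2)] in \<open>simp_all add: X_def\<close>)
  next
    case 3
    have "(1.0005 * (100/14) * r + (1.0005 * 0.2176) / y * r\<^sup>2)\<^sup>2 + X\<^sup>2 \<le> R\<^sup>2"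
      unfolding R_def X_def using polar_poly_middle_lower[OF r(1) 3(3)] polar_poly_middle_upper[OF r(1) 3(3)] r
      by (intro norm_chord_bound[OF _ 3(1,2)]) simp_all
    then show ?thesis
      by (intro key[of "100/14" "0.2176"]) (use ln_full_turn_tangents(2) in \<open>simp_all\<close>)
  next
    case 4
    have "(1.0005 * 3.3132 * r + (1.0005 * 0.9857) / y * r\<^sup>2)\<^sup>2 + X\<^sup>2 \<le> R\<^sup>2"
      unfolding R_def X_def using polar_poly_large_lower[OF r] polar_poly_large_upper[OF r] r
      by (intro norm_chord_bound[OF _ 4 y(2)]) simp_all
    then show ?thesis
      by (intro key[of "3.3132" "0.9857"]) (use ln_full_turn_tangents(3) in \<open>simp_all\<close>)
  qed
  have "(r\<^sup>2)\<^sup>2 * (g\<^sup>2 + (2 * r - 6.1)\<^sup>2) = (r\<^sup>2 * g)\<^sup>2 + X\<^sup>2"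
    by (simp add: X_def power2_eq_square algebra_simps)
  also have "\<dots> \<le> R\<^sup>2" by (rule main)
  also have "R = r\<^sup>2 * (6.278 / r + 2.1 / r\<^sup>2 + 2 * (1 - y))"
    using r by (simp add: R_def field_simps power2_eq_square)
  finally have "(r\<^sup>2)\<^sup>2 * (g\<^sup>2 + (2 * r - 6.1)\<^sup>2) \<le> (r\<^sup>2)\<^sup>2 * (6.278 / r + 2.1 / r\<^sup>2 + 2 * (1 - y))\<^sup>2"
    by (simp only: power_mult_distrib)
  then have "g\<^sup>2 + (2 * r - 6.1)\<^sup>2 \<le> (6.278 / r + 2.1 / r\<^sup>2 + 2 * (1 - y))\<^sup>2"
    using r by (subst (asm) mult_le_cancel_left_pos) auto
  then show ?thesis
    using r y by (intro real_le_lsqrt) auto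
qed

text \<open>Counterpart of \<open>sweep_bound\<close> for steps that set a new record distance, with
  \<open>v = M / l\<close>: there the radial part of the step is priced by the term
  \<open>2.1 * M / l\<close> alone.\<close>

lemma record_bound:
  fixes v :: real
  assumes v: "1 / 3.3132 \<le> v"
  defines "g \<equiv> 1.0005 * max 0 (ln (full_turn * v)) / v"
  shows "sqrt (g\<^sup>2 + 2.1\<^sup>2) \<le> 6.278 + 2.1 * v"
proof -
  have v0: "v > 0" using v by (rule less_le_trans[rotated]) simp
  have "g \<le> 1.0005 * (0.9857 + 3.3132 * v) / v"
    unfolding g_def using ln_full_turn_tangents(3)[OF v0] v0
    by (intro divide_right_mono mult_left_mono) auto
  \<comment> \<open>The bound \<open>3.3132 + 0.9857 / v\<close> decreases in \<open>v\<close>, so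
    \<open>v = 1 / 3.3132\<close> is the worst case.\<close>
  also have "\<dots> \<le> 1.0005 * 3.3132 * 1.9857"
    using v v0 by (simp add: field_simps)
  finally have g: "g \<le> 6.5824" by simp
  have "0 \<le> g" using v0 by (simp add: g_def)
  then have "g\<^sup>2 + 2.1\<^sup>2 \<le> 6.5824\<^sup>2 + 2.1\<^sup>2" using g by (intro add_right_mono power_mono)
  also have "\<dots> \<le> (6.278 + 2.1 / 3.3132)\<^sup>2" by (simp add: power_divide power2_eq_square)
  also have "\<dots> \<le> (6.278 + 2.1 * v)\<^sup>2"
    using v by (intro power_mono) auto
  finally show ?thesis using v0 by (intro real_le_lsqrt) auto
qed

section \<open>The potential and its change along one step\<close>

definition potential :: "real \<Rightarrow> real \<Rightarrow> real \<Rightarrow> real" where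
  "potential u M l = 2.1 * M / l - (2 * (l / M) - 6.1) * (1 - u / M)"

text \<open>The two terms are at most 2.1 and 4.1 in absolute value. Hence telescoping the potential
  over the whole path costs only a constant.\<close>

lemma potential_bounds:
  assumes "0 \<le> u" "u \<le> M" "0 < M" "M \<le> l" "l \<le> 3.3132 * M"
  shows "potential u M l \<le> 7" "- 7 \<le> potential u M l"
proof -
  define r y v where "r = l / M" and "y = 1 - u / M" and "v = M / l"
  have r: "1 \<le> r" "r \<le> 3.3132" and y: "0 \<le> y" "y \<le> 1" and v: "0 \<le> v" "v \<le> 1"
    using assms by (auto simp: r_def y_def v_def field_simps)
  have "\<bar>(2 * r - 6.1) * y\<bar> \<le> 4.1 * 1"
    unfolding abs_mult
  proof (intro mult_mono)
    show "\<bar>2 * r - 6.1\<bar> \<le> 4.1" using r by (intro abs_leI) auto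
  qed (use y in auto)
  moreover have "potential u M l = 2.1 * v - (2 * r - 6.1) * y"
    by (simp add: potential_def r_def y_def v_def)
  ultimately show "potential u M l \<le> 7" "- 7 \<le> potential u M l"
    using v unfolding abs_le_iff by linarith+
qed

text \<open>Applied with \<open>x\<close> and \<open>y\<close> the tangential and radial parts of a
  step, and \<open>a\<close> and \<open>b\<close> their prices in swept weight and in
  potential.\<close>

lemma cauchy_schwarz2:
  fixes a b x y c :: real
  assumes "x\<^sup>2 + y\<^sup>2 \<le> c\<^sup>2" "0 \<le> c"
  shows "a * x + b * y \<le> sqrt (a\<^sup>2 + b\<^sup>2) * c"
proof -
  have "a * x + b * y = Complex a b \<bullet> Complex x y"
    by (simp add: inner_complex_def)
  also have "\<dots> \<le> cmod (Complex a b) * cmod (Complex x y)"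
    by (rule norm_cauchy_schwarz)
  also have "cmod (Complex x y) \<le> c"
    using assms by (simp add: cmod_def real_le_lsqrt)
  finally show ?thesis by (simp add: cmod_def mult_left_mono)
qed

lemma ln_growth:
  fixes l e :: real
  assumes "0 < l" "0 \<le> e"
  shows "e / (l + e) \<le> ln ((l + e) / l)"
proof -
  have "- ln ((l + e) / l) = ln (l / (l + e))"
    using assms by (simp add: ln_div)
  also have "\<dots> \<le> l / (l + e) - 1"
    using assms by (intro ln_le_minus_one) auto
  also have "\<dots> = - (e / (l + e))"
    using assms by (simp add: field_simps)
  finally show ?thesis by simp
qed

text \<open>The errors of second order in \<open>e\<close> are absorbed by the gap between 6.278 and 6.28.\<close>

lemma discretisation_error:
  fixes l M e D :: real
  assumes l: "1 \<le> l" "0 < M" "M \<le> l" "l \<le> 3.3132 * M" and e: "0 \<le> e" "e \<le> (1 / 10 ^ 6)" "\<bar>D\<bar> \<le> e"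
  shows "6.278 * e / l + 2.1 * M * e / l\<^sup>2 + 2 * e * D / M\<^sup>2
     \<le> 6.28 * ln ((l + e) / l) + (2.1 * M / l - 2.1 * M / (l + e))"
proof -
  have l0: "0 < l" using l by simp
  define x where "x = e / l"
  have x: "0 \<le> x" "x \<le> (1 / 10 ^ 6)" "e \<le> (1 / 10 ^ 6) * l"
  proof -
    show "0 \<le> x" using e l by (simp add: x_def)
    show 1: "e \<le> (1 / 10 ^ 6) * l" using e l by auto
    then show "x \<le> (1 / 10 ^ 6)" using l0 by (simp add: x_def field_simps)
  qed
  have lam: "e = x * l" using l0 by (simp add: x_def)
  \<comment> \<open>Second-order term: \<open>D\<close> is at most \<open>e\<close> and
    \<open>l / M\<close> at most 3.3132, and twice the square of 3.3132 is below 22.\<close>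
  have "2 * e * D / M\<^sup>2 \<le> 2 * e * e / M\<^sup>2"
    using e l by (intro divide_right_mono mult_left_mono) auto
  also have "\<dots> = 2 * x\<^sup>2 * (l / M)\<^sup>2" by (simp add: lam power2_eq_square field_simps)
  also have "\<dots> \<le> 2 * x\<^sup>2 * 3.3132\<^sup>2"
    using l by (intro mult_left_mono power_mono) (auto simp: field_simps)
  also have "\<dots> \<le> 22 * ((1 / 10 ^ 6) * x)"
    using x mult_right_mono[OF x(2) x(1)] by (simp add: power2_eq_square power_divide)
  finally have 1: "2 * e * D / M\<^sup>2 \<le> 22 * ((1 / 10 ^ 6) * x)" .
  define a where "a = M / l"
  have "2.1 * M * e / l\<^sup>2 = 2.1 * a * x" "2.1 * M / l = 2.1 * a" "2.1 * M / (l + e) = 2.1 * a / (1 + x)"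
    using l0 x by (simp_all add: a_def lam field_simps power2_eq_square)
  then have "2.1 * M * e / l\<^sup>2 - (2.1 * M / l - 2.1 * M / (l + e)) = 2.1 * a * x - (2.1 * a - 2.1 * a / (1 + x))"
    by (simp only:)
  also have "\<dots> = 2.1 * a * (x - 1 + 1 / (1 + x))"
    using x by (simp add: field_simps)
  also have "x - 1 + 1 / (1 + x) = x * (x / (1 + x))"
    using x by (simp add: field_simps)
  also have "2.1 * a * \<dots> = 2.1 * (M / l) * (x * (x / (1 + x)))"
    by (simp add: a_def)
  also have "\<dots> \<le> 2.1 * 1 * (x * ((1 / 10 ^ 6) / 1))"
    using l x by (intro mult_mono frac_le) auto
  finally have 2: "2.1 * M * e / l\<^sup>2 - (2.1 * M / l - 2.1 * M / (l + e)) \<le> 2.1 * x * (1 / 10 ^ 6)" by simp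
  have "x * (1 - (1 / 10 ^ 6)) \<le> x / (1 + x)"
  proof -
    have "x * (1 - (1 / 10 ^ 6)) * (1 + x) \<le> x * ((1 - (1 / 10 ^ 6)) * (1 + (1 / 10 ^ 6)))"
      unfolding mult.assoc using x by (intro mult_left_mono) auto
    also have "\<dots> \<le> x" using x by simp
    finally show ?thesis using x by (simp add: field_simps)
  qed
  also have "x / (1 + x) = e / (l + e)"
  proof -
    have "l + e = (1 + x) * l" by (simp add: lam algebra_simps)
    then show ?thesis using l0 by (simp add: lam)
  qed
  also have "\<dots> \<le> ln ((l + e) / l)" using l0 e(1) by (rule ln_growth)
  finally have 3: "x * (1 - (1 / 10 ^ 6)) \<le> ln ((l + e) / l)" .
  have 4: "6.278 * e / l = 6.278 * x" by (simp add: x_def)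
  \<comment> \<open>The gap \<open>(6.28 - 6.278) * x\<close> dominates the collected errors, which
    stay below \<open>31 * x / 10 ^ 6\<close>.\<close>
  show ?thesis using 1 2 3 4 x(1) by simp
qed

text \<open>For steps that keep the record \<open>M\<close>. Swept weight plus radial change of the
  potential is an inner product with the step \<open>(\<tau>, D)\<close>, so Cauchy-Schwarz reduces
  the claim to \<open>sweep_bound\<close>.\<close>

lemma potential_step_flat:
  fixes u M l e D \<tau> q :: real
  assumes l: "1 \<le> l" "0 < M" "M \<le> l" "l \<le> 3.3132 * M" and u: "0 \<le> u" "u \<le> M"
    and e: "0 \<le> e" "e \<le> (1 / 10 ^ 6)" "\<tau>\<^sup>2 + D\<^sup>2 \<le> e\<^sup>2" "0 \<le> \<tau>"
    and q: "q \<le> 1.0004 * max 0 (ln (full_turn * u / l)) / u * \<tau>"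
  shows "q \<le> 6.28 * ln ((l + e) / l) + potential u M l - potential (u + D) M (l + e)"
proof -
  define r y c where "r = l / M" and "y = u / M" and "c = 2 * r - 6.1"
  define g where "g = 1.0005 * max 0 (ln (full_turn * y / r)) / y"
  have ry: "1 \<le> r" "r \<le> 3.3132" "0 \<le> y" "y \<le> 1"
    using l u by (auto simp: r_def y_def field_simps)
  have D: "\<bar>D\<bar> \<le> e"
  proof -
    have "D\<^sup>2 \<le> e\<^sup>2" using e(3) zero_le_power2[of \<tau>] by linarith
    then show ?thesis using e(1) by (simp add: abs_le_square_iff[symmetric])
  qed
  have "q \<le> 1.0005 * max 0 (ln (full_turn * u / l)) / u * \<tau>"
    using q by (rule order_trans) (use u e in \<open>intro mult_right_mono divide_right_mono, auto\<close>)
  also have "\<dots> = g * \<tau> / M"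
    using l by (simp add: g_def y_def r_def)
  finally have "q + c * D / M \<le> (g * \<tau> + c * D) / M" by (simp add: add_divide_distrib)
  also have "\<dots> \<le> sqrt (g\<^sup>2 + c\<^sup>2) * e / M"
    using cauchy_schwarz2[OF e(3,1)] l by (intro divide_right_mono) auto
  also have "\<dots> \<le> (6.278 / r + 2.1 / r\<^sup>2 + 2 * (1 - y)) * e / M"
    using sweep_bound[OF ry] e l unfolding g_def c_def by (intro divide_right_mono mult_right_mono) auto
  also have "\<dots> = 6.278 * e / l + 2.1 * M * e / l\<^sup>2 + 2 * e / M * (1 - y)"
    using l by (simp add: r_def field_simps power2_eq_square)
  finally have 1: "q + c * D / M \<le> 6.278 * e / l + 2.1 * M * e / l\<^sup>2 + 2 * e / M * (1 - y)" .
  \<comment> \<open>An exact expansion; the mixed term in \<open>e * D\<close> is the second-order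
    error handled by \<open>discretisation_error\<close>.\<close>
  have "potential u M l - potential (u + D) M (l + e)
     = 2.1 * M / l - 2.1 * M / (l + e) + 2 * e / M * (1 - y) - c * D / M - 2 * e * D / M\<^sup>2"
    unfolding potential_def c_def r_def y_def using l
    by (simp add: add_divide_distrib diff_divide_distrib power2_eq_square algebra_simps)
  with 1 discretisation_error[OF l e(1,2) D] show ?thesis by linarith
qed

text \<open>For steps that end at or beyond the old record. The new distance is its own record, so
  the second term of the potential vanishes afterwards.\<close>

lemma potential_step_record:
  fixes u M l e D \<tau> q :: real
  assumes l: "1 \<le> l" "0 < M" "M \<le> l" "l \<le> 3.3132 * M" and u: "0 \<le> u" "u \<le> M" "M \<le> u + D"
    and e: "0 \<le> e" "e \<le> (1 / 10 ^ 6)" "\<tau>\<^sup>2 + D\<^sup>2 \<le> e\<^sup>2" "0 \<le> \<tau>"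
    and q: "q \<le> 1.0004 * max 0 (ln (full_turn * u / l)) / u * \<tau>"
  shows "q \<le> 6.28 * ln ((l + e) / l) + potential u M l - potential (u + D) (u + D) (l + e)"
proof -
  define v where "v = M / l"
  define g where "g = 1.0005 * max 0 (ln (full_turn * v)) / v"
  have v: "1 / 3.3132 \<le> v" using l by (simp add: v_def field_simps)
  have v0: "0 < v" using l by (simp add: v_def)
  have M: "1 / 3.3132 \<le> M" using l by simp
  have D: "D \<le> e" "0 \<le> D"
  proof -
    have "D\<^sup>2 \<le> e\<^sup>2" using e(3) zero_le_power2[of \<tau>] by linarith
    then show "D \<le> e" using e(1) by (simp add: abs_le_square_iff[symmetric])
  qed (use u in simp)
  \<comment> \<open>A single step is so short that \<open>u\<close> is already almost
    \<open>M\<close>; this costs the passage from 1.0004 to 1.0005.\<close>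
  have uM: "(1.0004 / 1.0005) * M \<le> u" and u0: "0 < u" using u D e M by simp_all
  have "1.0004 * max 0 (ln (full_turn * u / l)) / u \<le> 1.0004 * max 0 (ln (full_turn * v)) / ((1.0004 / 1.0005) * M)"
  proof (intro frac_le mult_left_mono max.mono order.refl uM)
    show "ln (full_turn * u / l) \<le> ln (full_turn * v)"
      using u0 l full_turn_pos u by (subst ln_le_cancel_iff) (auto simp: v_def field_simps)
  qed (use l in auto)
  also have "\<dots> = g / l" using l by (simp add: g_def v_def)
  finally have "q \<le> g / l * \<tau>" using q e(4) by (meson mult_right_mono order_trans)
  then have "q + 2.1 * D / l \<le> (g * \<tau> + 2.1 * D) / l" by (simp add: add_divide_distrib)
  also have "\<dots> \<le> sqrt (g\<^sup>2 + 2.1\<^sup>2) * e / l"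
    using l by (intro divide_right_mono cauchy_schwarz2[OF e(3,1)]) auto
  also have "\<dots> \<le> (6.278 + 2.1 * v) * e / l"
    using record_bound[OF v] e l unfolding g_def by (intro divide_right_mono mult_right_mono) auto
  also have "\<dots> = 6.278 * e / l + 2.1 * M * e / l\<^sup>2"
    using l by (simp add: v_def field_simps power2_eq_square)
  finally have 1: "q + 2.1 * D / l \<le> 6.278 * e / l + 2.1 * M * e / l\<^sup>2" .
  \<comment> \<open>Losing the second term of the potential is no more expensive than climbing from
    \<open>u\<close> to \<open>M\<close> at the price \<open>2.1 / l\<close>; numerically, 0.5264 is
    at most \<open>2.1 / 3.3132\<close>.\<close>
  have c: "2 * (l / M) - 6.1 \<le> 2.1 * (M / l)"
  proof -
    have "l / M \<le> 3.3132" using l by (simp add: field_simps)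
    moreover have "2.1 / 3.3132 \<le> 2.1 * v" using v by simp
    ultimately show ?thesis by (simp add: v_def)
  qed
  have "(2 * (l / M) - 6.1) * (1 - u / M) \<le> 2.1 * (M / l) * (1 - u / M)"
    using c u l by (intro mult_right_mono) (auto simp: field_simps)
  also have "\<dots> = 2.1 * (M - u) / l" using l by (simp add: field_simps)
  finally have 2: "(2 * (l / M) - 6.1) * (1 - u / M) \<le> 2.1 * (M - u) / l" .
  have "2.1 * (u + D) / (l + e) = 2.1 * M / (l + e) + 2.1 * (u + D - M) / (l + e)"
    by (simp add: add_divide_distrib[symmetric] algebra_simps)
  also have "\<dots> \<le> 2.1 * M / (l + e) + 2.1 * (u + D - M) / l"
    using l u e by (intro add_left_mono divide_left_mono) auto
  finally have 3: "2.1 * (u + D) / (l + e) \<le> 2.1 * M / (l + e) + 2.1 * (u + D - M) / l" .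
  \<comment> \<open>The radial step is split into the climb up to the old record and the gain beyond
    it.\<close>
  have "2.1 * D / l = 2.1 * (u + D - M) / l + 2.1 * (M - u) / l"
    by (simp add: add_divide_distrib[symmetric] algebra_simps)
  moreover have "potential (u + D) (u + D) (l + e) = 2.1 * (u + D) / (l + e)"
    using u u0 l by (simp add: potential_def)
  ultimately show ?thesis
    using 1 2 3 discretisation_error[OF l e(1,2), of 0] e
    unfolding potential_def[of u M l] by simp
qed

section \<open>Environments that are star-shaped about the start\<close>

lemma cis_2pi_eq_imp:
  fixes x y :: real
  assumes "x \<in> {0..1}" "y \<in> {0..1}" "cis (2 * pi * x) = cis (2 * pi * y)"
  shows "x = y \<or> x = 0 \<and> y = 1 \<or> x = 1 \<and> y = 0"
proof -
  obtain n :: int where "\<i> * of_real (2 * pi * x) = \<i> * of_real (2 * pi * y) + (of_int (2 * n) * pi) * \<i>"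
    using assms(3) unfolding cis_conv_exp exp_eq by auto
  then have "\<i> * of_real (2 * pi * x) = \<i> * of_real (2 * pi * (y + of_int n))"
    by (simp add: algebra_simps)
  then have "2 * pi * x = 2 * pi * (y + of_int n)"
    by (simp only: mult_cancel_left of_real_eq_iff complex_i_not_zero simp_thms)
  then have "x = y + of_int n" by simp
  moreover from this assms have "- 1 \<le> real_of_int n" "real_of_int n \<le> 1" by auto
  then have "n = - 1 \<or> n = 0 \<or> n = 1" by linarith
  ultimately show ?thesis using assms by auto
qed

text \<open>The radial graph of \<open>f\<close> is a Jordan curve. Points beyond it escape to
  infinity along rays, and the points below it form a connected set that misses the curve; the
  Jordan curve theorem then identifies this set as part of the inside.\<close>

lemma star_environment:
  fixes f :: "complex \<Rightarrow> real" and s :: complex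
  assumes cont: "continuous_on (sphere 0 1) f" and pos: "\<And>e. norm e = 1 \<Longrightarrow> 0 < f e"
  obtains P where "environment P" "s \<in> interior P"
    and "frontier P = (\<lambda>e. s + of_real (f e) * e) ` sphere 0 1"
proof -
  define G where "G = (\<lambda>e. s + of_real (f e) * e) ` sphere 0 1"
  define g where "g = (\<lambda>t::real. s + of_real (f (cis (2 * pi * t))) * cis (2 * pi * t))"
  \<comment> \<open>The centre is inserted separately because \<open>sgn 0 = 0\<close> and nothing
    is known about \<open>f 0\<close>.\<close>
  define U where "U = insert s {z. norm (z - s) < f (sgn (z - s))}"
  have sg: "sgn (of_real a * e) = e" if "0 < a" "norm e = 1" for a :: real and e :: complex
    using that by (simp add: sgn_eq norm_mult)
  have im: "path_image g = G"
  proof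
    show "path_image g \<subseteq> G" by (auto simp: path_image_def g_def G_def)
    show "G \<subseteq> path_image g"
    proof
      fix z assume "z \<in> G"
      then obtain e where e: "norm e = 1" "z = s + of_real (f e) * e" by (auto simp: G_def)
      have "cis (2 * pi * (Arg2pi e / (2 * pi))) = e"
        using e(1) complex_norm_eq_1_exp[of e] by (simp add: cis_conv_exp)
      moreover have "Arg2pi e / (2 * pi) \<in> {0..1}"
        using Arg2pi_ge_0[of e] Arg2pi_lt_2pi[of e] by auto
      ultimately show "z \<in> path_image g"
        unfolding path_image_def g_def e(2) by (metis (no_types, lifting) imageI)
    qed
  qed
  have "path g"
    unfolding path_def g_def
    by (intro continuous_intros continuous_on_compose2[OF cont]) auto
  moreover have "loop_free g"
    unfolding loop_free_def
  proof (intro ballI impI)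
    fix x y :: real assume xy: "x \<in> {0..1}" "y \<in> {0..1}" "g x = g y"
    then have "sgn (g x - s) = sgn (g y - s)" by simp
    then have "cis (2 * pi * x) = cis (2 * pi * y)"
      by (simp add: g_def sg pos)
    then show "x = y \<or> x = 0 \<and> y = 1 \<or> x = 1 \<and> y = 0"
      using cis_2pi_eq_imp xy by blast
  qed
  ultimately have sp: "simple_path g" by (simp add: simple_path_def)
  have loop: "pathfinish g = pathstart g" by (simp add: pathfinish_def pathstart_def g_def)
  note J = Jordan_inside_outside[OF sp loop, unfolded im]
  have memG: "z \<in> G \<longleftrightarrow> z \<noteq> s \<and> norm (z - s) = f (sgn (z - s))" for z
  proof
    assume "z \<in> G"
    then obtain e where e: "norm e = 1" "z = s + of_real (f e) * e" by (auto simp: G_def)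
    with pos[of e] sg[of "f e" e] show "z \<noteq> s \<and> norm (z - s) = f (sgn (z - s))"
      by (auto simp: norm_mult)
  next
    assume z: "z \<noteq> s \<and> norm (z - s) = f (sgn (z - s))"
    then have "z = s + of_real (f (sgn (z - s))) * sgn (z - s)"
      by (simp add: sgn_eq flip: z[THEN conjunct2])
    moreover have "sgn (z - s) \<in> sphere 0 1" using z by (simp add: norm_sgn)
    ultimately show "z \<in> G" unfolding G_def by (rule image_eqI)
  qed
  have outside: "z \<in> outside G" if z: "z \<notin> U" "z \<notin> G" for z
  proof -
    \<comment> \<open>The ray from \<open>z\<close> pointing away from \<open>s\<close> is
      connected, unbounded and misses the curve.\<close>
    define R where "R = (\<lambda>c::real. s + of_real c * (z - s)) ` {1..}"
    have zs: "z \<noteq> s" "norm (z - s) > f (sgn (z - s))"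
      using z memG[of z] by (auto simp: U_def)
    have "R \<inter> G = {}"
    proof -
      have "s + of_real c * (z - s) \<notin> G" if "1 \<le> c" for c :: real
      proof -
        have "sgn (of_real c * (z - s)) = sgn (z - s)"
          using that by (simp add: sgn_eq norm_mult)
        moreover have "norm (of_real c * (z - s)) \<ge> norm (z - s)"
          using that mult_right_mono[of 1 c "norm (z - s)"] by (simp add: norm_mult)
        ultimately show ?thesis using zs(2) unfolding memG by simp
      qed
      then show ?thesis by (auto simp: R_def)
    qed
    moreover have "connected R"
      unfolding R_def by (intro connected_continuous_image continuous_intros) auto
    moreover have "z \<in> R" unfolding R_def by (rule image_eqI[of _ _ 1]) auto
    ultimately have sub: "R \<subseteq> connected_component_set (- G) z"
      by (intro connected_component_maximal) auto
    have "\<not> bounded R"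
    proof
      assume "bounded R"
      then obtain B where B: "\<And>w. w \<in> R \<Longrightarrow> norm w \<le> B" by (auto simp: bounded_iff)
      define c where "c = 1 + (\<bar>B\<bar> + norm s) / norm (z - s)"
      have "1 \<le> c" by (simp add: c_def)
      then have "norm (s + of_real c * (z - s)) \<le> B" by (intro B) (auto simp: R_def)
      moreover have "norm (s + of_real c * (z - s)) \<ge> c * norm (z - s) - norm s"
        using norm_diff_ineq[of "of_real c * (z - s)" s] \<open>1 \<le> c\<close>
        by (simp add: norm_mult add.commute)
      moreover have "c * norm (z - s) = norm (z - s) + \<bar>B\<bar> + norm s"
        using zs by (simp add: c_def field_simps)
      moreover have "0 < norm (z - s)" using zs by simp
      ultimately show False by linarith
    qed
    then show ?thesis
      using sub bounded_subset unfolding outside by blast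
  qed
  have UG: "U \<inter> G = {}"
  proof -
    have "z \<notin> G" if "z \<in> U" for z using that memG[of z] by (auto simp: U_def)
    then show ?thesis by blast
  qed
  have "starlike U"
    unfolding starlike_def
  proof (intro bexI ballI subsetI)
    show "s \<in> U" by (simp add: U_def)
    fix z w assume z: "z \<in> U" and "w \<in> closed_segment s z"
    then obtain u where u: "0 \<le> u" "u \<le> 1" "w = (1 - u) *\<^sub>R s + u *\<^sub>R z"
      by (auto simp: closed_segment_def)
    then have w: "w - s = of_real u * (z - s)" by (simp add: scaleR_conv_of_real algebra_simps)
    show "w \<in> U"
    proof (cases "u = 0 \<or> z = s")
      case True then show ?thesis using w by (auto simp: U_def)
    next
      case False
      then have "sgn (w - s) = sgn (z - s)" using u unfolding w by (simp add: sgn_eq norm_mult)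
      moreover have "norm (w - s) \<le> norm (z - s)"
        using u unfolding w by (simp add: norm_mult mult_left_le_one_le)
      ultimately show ?thesis using z False by (auto simp: U_def)
    qed
  qed
  then have conU: "connected U" by (rule starlike_imp_connected)
  obtain w where w: "w \<in> inside G" using J by auto
  \<comment> \<open>The inside is nonempty, and every point off \<open>U\<close> and
    \<open>G\<close> is outside.\<close>
  then have "w \<in> U"
    using outside[of w] J inside_no_overlap[of G] by blast
  then have Uin: "U \<subseteq> inside G"
    using conU UG w by (metis connected_componentI disjoint_eq_subset_Compl inside_same_component subsetI)
  define P where "P = G \<union> inside G"
  have "environment P"
    unfolding environment_def P_def using sp loop im by metis
  moreover have inP: "inside G \<subseteq> interior P"
    using J by (intro interior_maximal) (auto simp: P_def)
  then have "s \<in> interior P" using Uin by (auto simp: U_def)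
  moreover have "frontier P = G"
  proof
    have "closed P"
    proof -
      have "P = closure (inside G)" using J unfolding P_def closure_Un_frontier by auto
      then show ?thesis by simp
    qed
    then have "frontier P = P - interior P" by (simp add: frontier_def)
    then show "frontier P \<subseteq> G" using inP P_def by blast
    \<comment> \<open>By the Jordan curve theorem every point of the curve is a limit of outside
      points.\<close>
    show "G \<subseteq> frontier P"
    proof
      fix x assume x: "x \<in> G"
      then have "x \<in> closure (outside G)" using J unfolding frontier_def by blast
      moreover have "outside G \<subseteq> - P" using J unfolding P_def by blast
      ultimately have "x \<notin> interior P"
        using closure_mono unfolding interior_closure by blast
      then show "x \<in> frontier P" using x closure_subset[of P] by (auto simp: frontier_def P_def)
    qed
  qed
  ultimately show thesis using that unfolding G_def by blast
qed

section \<open>Length bounds for competitive strategies\<close>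

lemma curve_length_nonneg: "0 \<le> curve_length f a b"
  unfolding curve_length_def by (rule SUP_upper2[of "[]"]) (auto simp: zero_ereal_def)

lemma curve_length_mono: "b \<le> c \<Longrightarrow> curve_length f a b \<le> curve_length f a c"
  unfolding curve_length_def by (rule SUP_subset_mono) auto

lemma curve_length_translate: "curve_length (\<lambda>t. s + S t) a b = curve_length S a b"
  by (simp add: curve_length_def)

lemma curve_length_extend:
  assumes "ereal l \<le> curve_length f a b" "a \<le> b" "b \<le> c"
  shows "ereal (l + dist (f b) (f c)) \<le> curve_length f a c"
proof -
  let ?T = "\<lambda>b. {ts. sorted ts \<and> set ts \<subseteq> {a..b}}"
  let ?sum = "\<lambda>ts. \<Sum>i<length ts - 1. dist (f (ts ! i)) (f (ts ! Suc i))"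
  have ext: "ereal (?sum ts) + ereal (dist (f b) (f c)) \<le> curve_length f a c" if ts: "ts \<in> ?T b" for ts
  proof -
    \<comment> \<open>Appending \<open>b\<close> before \<open>c\<close> makes the last chord
      exactly the one from \<open>b\<close> to \<open>c\<close>; the chord leading to
      \<open>b\<close> only adds length.\<close>
    define us where "us = ts @ [b, c]"
    have us: "us \<in> ?T c" using ts assms(2,3) by (fastforce simp: us_def sorted_append)
    have "?sum ts \<le> (\<Sum>i<length ts. dist (f (us ! i)) (f (us ! Suc i)))"
    proof -
      have "?sum ts = (\<Sum>i<length ts - 1. dist (f (us ! i)) (f (us ! Suc i)))"
        by (intro sum.cong) (auto simp: us_def nth_append)
      also have "\<dots> \<le> (\<Sum>i<length ts. dist (f (us ! i)) (f (us ! Suc i)))"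
        by (intro sum_mono2) auto
      finally show ?thesis .
    qed
    moreover have "?sum us = (\<Sum>i<length ts. dist (f (us ! i)) (f (us ! Suc i))) + dist (f b) (f c)"
      by (simp add: us_def nth_append)
    ultimately have "?sum ts + dist (f b) (f c) \<le> ?sum us" by simp
    then have "ereal (?sum ts) + ereal (dist (f b) (f c)) \<le> ereal (?sum us)" by simp
    also have "\<dots> \<le> curve_length f a c"
      unfolding curve_length_def by (rule SUP_upper[OF us])
    finally show ?thesis .
  qed
  have "ereal l + ereal (dist (f b) (f c)) \<le> curve_length f a b + ereal (dist (f b) (f c))"
    by (rule add_right_mono[OF assms(1)])
  also have "\<dots> = (SUP ts\<in>?T b. ereal (?sum ts) + ereal (dist (f b) (f c)))"
    unfolding curve_length_def
    by (rule SUP_ereal_add_left[symmetric]) (auto intro: exI[of _ "[]"])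
  also have "\<dots> \<le> curve_length f a c" by (rule SUP_least) (rule ext)
  finally show ?thesis by simp
qed

lemma arc_angle_bounds: "0 \<le> arc_angle P s x" "arc_angle P s x \<le> 2 * pi"
proof -
  let ?A = "{phi. 0 \<le> phi \<and> phi \<le> 2 * pi \<and> (\<exists>a. \<forall>\<theta>\<in>{a..a + phi}. s + of_real x * cis \<theta> \<in> interior P)}"
  have "bdd_above ({0} \<union> ?A)" by (rule bdd_aboveI[of _ "2 * pi"]) auto
  then show "0 \<le> arc_angle P s x" unfolding arc_angle_def by (rule cSup_upper[rotated]) simp
  show "arc_angle P s x \<le> 2 * pi" unfolding arc_angle_def by (rule cSup_least) auto
qed

lemma arc_angle_sphere_frontier:
  assumes "0 < x" "sphere s x \<subseteq> frontier P"
  shows "arc_angle P s x = 0"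
proof -
  have "s + of_real x * cis \<theta> \<notin> interior P" for \<theta>
  proof -
    have "s + of_real x * cis \<theta> \<in> sphere s x" using assms(1) by (simp add: dist_norm norm_mult)
    then show ?thesis using assms(2) by (auto simp: frontier_def)
  qed
  then have "{phi. 0 \<le> phi \<and> phi \<le> 2 * pi \<and> (\<exists>a. \<forall>\<theta>\<in>{a..a + phi}. s + of_real x * cis \<theta> \<in> interior P)} = {}"
    by force
  then show ?thesis unfolding arc_angle_def by (simp only: Un_empty_right cSup_singleton)
qed

lemma certificate_length_bounds:
  assumes "z \<in> frontier P" "dist s z = x" "0 < x"
  shows "0 \<le> certificate_length P s" "certificate_length P s \<le> x * (1 + arc_angle P s x)"
proof -
  let ?X = "{x. 0 < x \<and> sphere s x \<inter> frontier P \<noteq> {}}"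
  have x: "x \<in> ?X" using assms by auto
  have nn: "0 \<le> y * (1 + arc_angle P s y)" if "y \<in> ?X" for y
    using that arc_angle_bounds(1)[of P s y] by auto
  show "0 \<le> certificate_length P s"
    unfolding certificate_length_def using x nn by (intro cINF_greatest) auto
  show "certificate_length P s \<le> x * (1 + arc_angle P s x)"
    unfolding certificate_length_def using nn by (intro cINF_lower[OF _ x]) (auto intro!: bdd_belowI2)
qed

section \<open>Consequences of a bounded ratio\<close>

definition competitive :: "(real \<Rightarrow> complex) \<Rightarrow> complex \<Rightarrow> real \<Rightarrow> bool" where
  "competitive S s C \<longleftrightarrow> escape_strategy S s \<and> 0 \<le> C \<and>
     (\<forall>P. environment P \<and> s \<in> interior P \<longrightarrow>
        curve_length (\<lambda>t. s + S t) 0 (first_hit S s P) / ereal (certificate_length P s) \<le> ereal C)"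

text \<open>Without contact up to time \<open>t\<close> the first hit comes no earlier than
  \<open>t\<close>, so the length up to \<open>t\<close> is at most \<open>C\<close> times the
  certificate.\<close>

lemma competitive_length_bound:
  assumes comp: "competitive S s C" and P: "environment P" "s \<in> interior P"
    and t: "0 \<le> t" "\<And>\<tau>. 0 \<le> \<tau> \<Longrightarrow> \<tau> \<le> t \<Longrightarrow> s + S \<tau> \<notin> frontier P"
    and cert: "0 \<le> certificate_length P s" "certificate_length P s \<le> B"
  shows "curve_length S 0 t \<le> ereal (C * B)"
proof -
  let ?H = "{t. 0 \<le> t \<and> s + S t \<in> frontier P}"
  define L where "L = curve_length S 0 (first_hit S s P)"
  have "?H \<noteq> {}" using comp P unfolding competitive_def escape_strategy_def by auto
  moreover have "t \<le> u" if "u \<in> ?H" for u using that t(2)[of u] by force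
  ultimately have "t \<le> first_hit S s P" unfolding first_hit_def by (intro cInf_greatest) auto
  then have "curve_length S 0 t \<le> L" unfolding L_def by (rule curve_length_mono)
  also have "L \<le> ereal (C * B)"
  proof -
    have q: "L / ereal (certificate_length P s) \<le> ereal C" and C: "0 \<le> C"
      using comp P unfolding competitive_def L_def curve_length_translate by auto
    have CB: "C * certificate_length P s \<le> C * B" using cert C by (intro mult_left_mono) auto
    have L0: "0 \<le> L" by (simp add: L_def curve_length_nonneg)
    show ?thesis
    proof (cases "certificate_length P s = 0")
      case True
      \<comment> \<open>In \<open>ereal\<close> a positive length divided by 0 is infinite, so the
        ratio bound forces length 0.\<close>
      have "L = 0"
      proof (rule ccontr)
        assume "L \<noteq> 0"
        then have "L / ereal (certificate_length P s) = \<infinity>"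
          using L0 True by (cases L) (auto simp: divide_ereal_def)
        then show False using q by simp
      qed
      then show ?thesis using CB True by simp
    next
      case False
      then have "0 < certificate_length P s" using cert by simp
      then have "L \<le> ereal (C * certificate_length P s)"
        using q L0 by (cases L) (auto simp: field_simps)
      then show ?thesis using CB by (meson ereal_less_eq(3) order_trans)
    qed
  qed
  finally show ?thesis .
qed

text \<open>Tested on the disc of radius \<open>x\<close>: its boundary is the circle itself, so the
  arc angle is 0 and the certificate at most \<open>x\<close>.\<close>

lemma competitive_disc:
  assumes "competitive S s C" "0 \<le> t" "0 < x" "\<And>\<tau>. 0 \<le> \<tau> \<Longrightarrow> \<tau> \<le> t \<Longrightarrow> norm (S \<tau>) < x"
  shows "curve_length S 0 t \<le> ereal (C * x)"
proof -
  obtain P where P: "environment P" "s \<in> interior P"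
    and fr: "frontier P = (\<lambda>e. s + of_real x * e) ` sphere 0 1"
    using star_environment[of "\<lambda>_. x" s] assms(3) by auto
  have mem: "z \<in> frontier P \<Longrightarrow> norm (z - s) = x" for z
    using assms(3) unfolding fr by (auto simp: norm_mult)
  have sub: "sphere s x \<subseteq> frontier P"
  proof
    fix z assume z: "z \<in> sphere s x"
    then have "z = s + of_real x * ((z - s) / of_real x)" using assms(3) by simp
    moreover have "(z - s) / of_real x \<in> sphere 0 1"
      using z assms(3) by (simp add: norm_divide dist_norm norm_minus_commute)
    ultimately show "z \<in> frontier P" unfolding fr by (rule image_eqI)
  qed
  have "s + of_real x \<in> sphere s x" using assms(3) by (simp add: dist_norm)
  with sub have z: "s + of_real x \<in> frontier P" by blast
  have "dist s (s + of_real x) = x" using assms(3) by (simp add: dist_norm)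
  note cert = certificate_length_bounds[OF z this assms(3)]
  show ?thesis
  proof (rule competitive_length_bound[OF assms(1) P assms(2) _ cert(1)])
    show "certificate_length P s \<le> x"
      using cert(2) arc_angle_sphere_frontier[OF assms(3) sub] by simp
    show "s + S \<tau> \<notin> frontier P" if "0 \<le> \<tau>" "\<tau> \<le> t" for \<tau>
      using assms(4)[OF that] mem[of "s + S \<tau>"] by auto
  qed
qed

text \<open>Tested on an environment whose boundary comes to distance \<open>x\<close> only in
  direction \<open>d\<close> and rises too steeply elsewhere to be touched by the path. A full turn
  at radius \<open>x\<close> bounds the certificate.\<close>

lemma competitive_ray:
  assumes comp: "competitive S s C" and t: "0 \<le> t" and x: "0 < x" and d: "norm d = 1"
    and ray: "\<And>\<tau> \<rho>. 0 \<le> \<tau> \<Longrightarrow> \<tau> \<le> t \<Longrightarrow> x \<le> \<rho> \<Longrightarrow> S \<tau> \<noteq> of_real \<rho> * d"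
  shows "curve_length S 0 t \<le> ereal (C * (x * (1 + 2 * pi)))"
proof -
  have cont: "continuous_on {0..t} S"
    using comp continuous_on_subset unfolding competitive_def escape_strategy_def by fastforce
  \<comment> \<open>The boundary has distance at least \<open>x\<close> everywhere, so only this
    part of the path could touch it.\<close>
  define F where "F = S ` {0..t} \<inter> {z. x \<le> norm z}"
  have "compact F"
    unfolding F_def using cont
    by (intro compact_Int_closed compact_continuous_image closed_Collect_le continuous_intros) auto
  then obtain R where R: "\<And>z. z \<in> F \<Longrightarrow> norm z \<le> R" and "0 < R"
    using compact_imp_bounded bounded_pos by metis
  have F0: "z \<noteq> 0" if "z \<in> F" for z using that x by (auto simp: F_def)
  have away: "sgn z \<noteq> d" if "z \<in> F" for z
  proof
    assume "sgn z = d"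
    then have "z = of_real (norm z) * d" using F0[OF that] by (auto simp: sgn_eq)
    then show False using that ray by (auto simp: F_def)
  qed
  have "compact (sgn ` F)"
    using F0 by (intro compact_continuous_image[OF _ \<open>compact F\<close>] continuous_intros) auto
  moreover have "d \<notin> sgn ` F" using away by blast
  ultimately obtain \<delta> where \<delta>: "0 < \<delta>" "\<And>z. z \<in> F \<Longrightarrow> \<delta> \<le> dist d (sgn z)"
    using separate_point_closed[of "sgn ` F" d] compact_imp_closed by (metis imageI)
  \<comment> \<open>Directions of \<open>F\<close> differ from \<open>d\<close> by at least
    \<open>\<delta>\<close>, so over them the boundary lies at distance at least
    \<open>x + R\<close>, beyond every point of \<open>F\<close>.\<close>
  define f where "f = (\<lambda>e::complex. x + R / \<delta> * dist d e)"
  have fx: "x \<le> f e" for e using \<open>0 < R\<close> \<delta>(1) by (simp add: f_def)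
  obtain P where P: "environment P" "s \<in> interior P"
    and fr: "frontier P = (\<lambda>e. s + of_real (f e) * e) ` sphere 0 1"
  proof (rule star_environment[of f s])
    show "continuous_on (sphere 0 1) f" unfolding f_def by (intro continuous_intros)
    show "0 < f e" for e using fx[of e] x by simp
  qed auto
  have mem: "z \<in> frontier P \<Longrightarrow> norm (z - s) = f (sgn (z - s))" for z
  proof -
    assume "z \<in> frontier P"
    then obtain e where e: "norm e = 1" "z = s + of_real (f e) * e" unfolding fr by auto
    have "0 < f e" using fx[of e] x by simp
    with e show ?thesis by (simp add: norm_mult sgn_eq)
  qed
  have "f d = x" by (simp add: f_def)
  then have z: "s + of_real x * d \<in> frontier P" using d unfolding fr by force
  have "dist s (s + of_real x * d) = x" using x d by (simp add: dist_norm norm_mult)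
  note cert = certificate_length_bounds[OF z this x]
  show ?thesis
  proof (rule competitive_length_bound[OF comp P t _ cert(1)])
    have "x * (1 + arc_angle P s x) \<le> x * (1 + 2 * pi)"
      using arc_angle_bounds(2) x by (intro mult_left_mono) auto
    with cert(2) show "certificate_length P s \<le> x * (1 + 2 * pi)" by linarith
    show "s + S \<tau> \<notin> frontier P" if \<tau>: "0 \<le> \<tau>" "\<tau> \<le> t" for \<tau>
    proof
      assume "s + S \<tau> \<in> frontier P"
      then have eq: "norm (S \<tau>) = f (sgn (S \<tau>))" using mem by fastforce
      then have "S \<tau> \<in> F" using \<tau> fx[of "sgn (S \<tau>)"] by (auto simp: F_def)
      then have "R / \<delta> * \<delta> \<le> R / \<delta> * dist d (sgn (S \<tau>))"
        using \<delta> \<open>0 < R\<close> by (intro mult_left_mono) auto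
      then have "norm (S \<tau>) \<ge> x + R" using eq \<delta>(1) by (simp add: f_def)
      then show False using R[OF \<open>S \<tau> \<in> F\<close>] x by simp
    qed
  qed
qed

section \<open>Directions visited by short pieces of a path\<close>

text \<open>The second interval catches the part of the arc that wraps past
  \<open>2 * pi\<close>.\<close>

definition arc_set :: "real \<Rightarrow> real \<Rightarrow> real set" where
  "arc_set \<alpha> \<phi> = {0..2 * pi} \<inter> ({\<alpha>..\<alpha> + \<phi>} \<union> {\<alpha> - 2 * pi..\<alpha> + \<phi> - 2 * pi})"

lemma arc_set_sets [measurable]: "arc_set \<alpha> \<phi> \<in> sets borel"
  by (simp add: arc_set_def)

lemma emeasure_arc_set_finite: "emeasure lborel (arc_set \<alpha> \<phi>) < \<infinity>"
proof -
  have "emeasure lborel (arc_set \<alpha> \<phi>) \<le> emeasure lborel {0..2 * pi}"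
    by (intro emeasure_mono) (auto simp: arc_set_def)
  also have "\<dots> < \<infinity>" by simp
  finally show ?thesis .
qed

lemma measure_arc_set:
  assumes "0 \<le> \<alpha>" "\<alpha> < 2 * pi" "0 \<le> \<phi>"
  shows "measure lborel (arc_set \<alpha> \<phi>) \<le> \<phi>"
proof (cases "\<alpha> + \<phi> \<le> 2 * pi")
  case True
  have 0: "{0::real} \<in> fmeasurable lborel" "{\<alpha>..\<alpha> + \<phi>} \<in> fmeasurable lborel"
    by (rule fmeasurable_compact, simp)+
  have "measure lborel (arc_set \<alpha> \<phi>) \<le> measure lborel ({\<alpha>..\<alpha> + \<phi>} \<union> {0})"
    using assms True
    by (intro measure_mono_fmeasurable fmeasurable.Un 0) (auto simp: arc_set_def)
  also have "\<dots> \<le> measure lborel {\<alpha>..\<alpha> + \<phi>} + measure lborel {0::real}"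
    by (intro measure_Un_le) auto
  finally show ?thesis using assms by simp
next
  case False
  have "measure lborel (arc_set \<alpha> \<phi>) \<le> measure lborel ({\<alpha>..2 * pi} \<union> {0..\<alpha> + \<phi> - 2 * pi})"
    using assms by (intro measure_mono_fmeasurable fmeasurable_compact compact_Un) (auto simp: arc_set_def)
  also have "\<dots> \<le> measure lborel {\<alpha>..2 * pi} + measure lborel {0..\<alpha> + \<phi> - 2 * pi}"
    by (intro measure_Un_le) auto
  finally show ?thesis using assms False by simp
qed

lemma cis_in_arc_set:
  assumes t: "\<alpha> \<le> t" "t \<le> \<alpha> + \<phi>" and "0 \<le> \<alpha>" "\<alpha> + \<phi> < 4 * pi"
    and \<theta>: "0 \<le> \<theta>" "\<theta> < 2 * pi" and eq: "cis t = cis \<theta>"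
  shows "\<theta> \<in> arc_set \<alpha> \<phi>"
proof -
  obtain n :: int where "\<i> * of_real t = \<i> * of_real \<theta> + (of_int (2 * n) * pi) * \<i>"
    using eq unfolding cis_conv_exp exp_eq by auto
  then have "\<i> * of_real t = \<i> * of_real (\<theta> + 2 * pi * of_int n)"
    by (simp add: algebra_simps)
  then have n: "t = \<theta> + 2 * pi * of_int n"
    by (simp only: mult_cancel_left of_real_eq_iff complex_i_not_zero simp_thms)
  \<comment> \<open>The difference of \<open>t\<close> and \<open>\<theta>\<close> lies strictly
    between \<open>- 2 * pi\<close> and \<open>4 * pi\<close>, which leaves the two intervals of
    \<open>arc_set\<close>.\<close>
  have "2 * pi * (- 1) < 2 * pi * of_int n" "2 * pi * of_int n < 2 * pi * 2"
    using assms n by linarith+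
  then have "- 1 < real_of_int n" "real_of_int n < 2"
    using mult_less_cancel_left_pos[of "2 * pi"] pi_gt_zero by (metis zero_less_mult_iff zero_less_numeral)+
  then have "n = 0 \<or> n = 1" by linarith
  then show ?thesis using n t \<theta> unfolding arc_set_def by auto
qed

text \<open>Double counting: the pointwise bound is integrated over the directions and the sum
  exchanged with the integral.\<close>

lemma covering_weight:
  fixes w :: "'i \<Rightarrow> real" and B :: "'i \<Rightarrow> real set"
  assumes I: "finite I" and w: "\<And>i. i \<in> I \<Longrightarrow> 0 \<le> w i"
    and B: "\<And>i. i \<in> I \<Longrightarrow> B i \<in> sets borel" "\<And>i. i \<in> I \<Longrightarrow> emeasure lborel (B i) < \<infinity>"
    and cover: "\<And>\<theta>. 0 \<le> \<theta> \<Longrightarrow> \<theta> < 2 * pi \<Longrightarrow> c \<le> (\<Sum>i\<in>{i \<in> I. \<theta> \<in> B i}. w i)"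
  shows "2 * pi * c \<le> (\<Sum>i\<in>I. w i * measure lborel (B i))"
proof -
  have "2 * pi * c = (\<integral>\<theta>. c * indicator {0..<2 * pi} \<theta> \<partial>lborel)"
    by simp
  also have "\<dots> \<le> (\<integral>\<theta>. (\<Sum>i\<in>I. w i * indicator (B i) \<theta>) \<partial>lborel)"
  proof (rule integral_mono)
    show "integrable lborel (\<lambda>\<theta>. c * indicator {0..<2 * pi} \<theta>)" by simp
    show "integrable lborel (\<lambda>\<theta>. \<Sum>i\<in>I. w i * indicator (B i) \<theta>)"
      using B by (intro Bochner_Integration.integrable_sum integrable_mult_right integrable_real_indicator) auto
    fix \<theta> :: real
    have "(\<Sum>i\<in>I. w i * indicator (B i) \<theta>) = (\<Sum>i\<in>I. if \<theta> \<in> B i then w i else 0)"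
      by (intro sum.cong) auto
    also have "\<dots> = (\<Sum>i\<in>{i \<in> I. \<theta> \<in> B i}. w i)"
      by (rule sum.inter_filter[OF I, symmetric])
    finally have "(\<Sum>i\<in>I. w i * indicator (B i) \<theta>) = (\<Sum>i\<in>{i \<in> I. \<theta> \<in> B i}. w i)" .
    moreover have "0 \<le> (\<Sum>i\<in>{i \<in> I. \<theta> \<in> B i}. w i)" using w by (intro sum_nonneg) auto
    ultimately show "c * indicator {0..<2 * pi} \<theta> \<le> (\<Sum>i\<in>I. w i * indicator (B i) \<theta>)"
      using cover[of \<theta>] by (auto simp: indicator_def)
  qed
  also have "\<dots> = (\<Sum>i\<in>I. w i * measure lborel (B i))"
    using B by (subst Bochner_Integration.integral_sum) (auto intro!: integrable_mult_right integrable_real_indicator)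
  finally show ?thesis .
qed

section \<open>Polar geometry of a short piece\<close>

text \<open>Law of cosines in half-angle form, separating the radial from the tangential part of a
  chord.\<close>

lemma dist_polar_sq:
  fixes a b r q :: real
  shows "(cmod (of_real r * cis a - of_real q * cis b))\<^sup>2 = (r - q)\<^sup>2 + 4 * r * q * (sin ((a - b) / 2))\<^sup>2"
proof -
  have "(cmod (of_real r * cis a - of_real q * cis b))\<^sup>2
      = (r * cos a - q * cos b)\<^sup>2 + (r * sin a - q * sin b)\<^sup>2"
    by (simp add: cmod_power2)
  also have "\<dots> = r\<^sup>2 * ((cos a)\<^sup>2 + (sin a)\<^sup>2) + q\<^sup>2 * ((cos b)\<^sup>2 + (sin b)\<^sup>2) - 2 * r * q * cos (a - b)"
    unfolding cos_diff by algebra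
  also have "cos (a - b) = 1 - 2 * (sin ((a - b) / 2))\<^sup>2"
    using cos_double_sin[of "(a - b) / 2"] by (simp only: mult_2 field_sum_of_halves)
  finally show ?thesis by (simp add: power2_eq_square algebra_simps)
qed

text \<open>Each of the three legs dominates a plane vector with its radial change as first entry;
  only the middle one carries the tangential entry \<open>\<sigma>\<close>. The triangle inequality
  for their sum gives the claim.\<close>

lemma polar_length_bound:
  fixes p x y b :: complex
  assumes "(norm (y - x))\<^sup>2 = (norm y - norm x)\<^sup>2 + \<sigma>\<^sup>2" "0 \<le> \<sigma>"
  shows "\<sigma>\<^sup>2 + (norm b - norm p)\<^sup>2 \<le> (norm (x - p) + norm (y - x) + norm (b - y))\<^sup>2"
proof -
  have 1: "cmod (Complex (norm x - norm p) 0) \<le> norm (x - p)"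
    using norm_triangle_ineq3[of x p] by (simp add: cmod_def)
  have 2: "cmod (Complex (norm y - norm x) \<sigma>) = norm (y - x)"
    using assms by (simp add: cmod_def flip: assms(1))
  have 3: "cmod (Complex (norm b - norm y) 0) \<le> norm (b - y)"
    using norm_triangle_ineq3[of b y] by (simp add: cmod_def)
  have "\<sigma>\<^sup>2 + (norm b - norm p)\<^sup>2 = (cmod (Complex (norm b - norm p) \<sigma>))\<^sup>2"
    by (simp add: cmod_power2)
  also have "Complex (norm b - norm p) \<sigma>
    = Complex (norm x - norm p) 0 + Complex (norm y - norm x) \<sigma> + Complex (norm b - norm y) 0"
    by (simp add: complex_eq_iff)
  also have "(cmod \<dots>)\<^sup>2 \<le> (norm (x - p) + norm (y - x) + norm (b - y))\<^sup>2"
    using 1 2 3 by (intro power_mono norm_triangle_le add_mono) auto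
  finally show ?thesis .
qed

lemma sin_half_lower:
  fixes \<phi> :: real
  assumes "0 \<le> \<phi>" "\<phi> \<le> 1 / 100"
  shows "\<phi> * (1 - 1 / 10 ^ 4) \<le> 2 * sin (\<phi> / 2)"
proof -
  have "\<bar>sin (\<phi> / 2) - \<phi> / 2\<bar> \<le> (\<phi> / 2) ^ 3 / 6"
    using Maclaurin_sin_bound[of "\<phi> / 2" 3] assms
    by (simp add: sin_coeff_def fact_numeral eval_nat_numeral)
  moreover have "\<phi> ^ 3 \<le> \<phi> * (1 / 100)\<^sup>2"
    unfolding power3_eq_cube power2_eq_square mult.assoc using assms
    by (intro mult_left_mono mult_mono) auto
  moreover have "(\<phi> / 2) ^ 3 = \<phi> ^ 3 / 8" by (simp add: power_divide)
  ultimately have "\<phi> / 2 - \<phi> * (1 / 100)\<^sup>2 / 48 \<le> sin (\<phi> / 2)" by (simp only: abs_le_iff) linarith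
  then show ?thesis using assms(1) by (simp add: power_divide)
qed

text \<open>The polar angle attains its extremes on the piece. All visited directions lie in the arc
  between them, and the path must travel from one extreme to the other, which costs tangential
  length about \<open>norm (S a) * \<phi>\<close>.\<close>

lemma piece_geometry:
  fixes S :: "real \<Rightarrow> complex"
  assumes ab: "a \<le> b" and cont: "continuous_on {a..b} S" and p: "S a \<noteq> 0"
    and near: "\<And>\<tau>. a \<le> \<tau> \<Longrightarrow> \<tau> \<le> b \<Longrightarrow> norm (S \<tau> - S a) \<le> norm (S a) / 10 ^ 5"
  obtains \<alpha> \<phi> x y where "0 \<le> \<alpha>" "\<alpha> < 2 * pi" "0 \<le> \<phi>" "a \<le> x" "x \<le> y" "y \<le> b"
    and "(norm (S a) * \<phi> / 1.0004)\<^sup>2 + (norm (S b) - norm (S a))\<^sup>2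
           \<le> (norm (S x - S a) + norm (S y - S x) + norm (S b - S y))\<^sup>2"
    and "\<And>\<tau> \<rho> \<theta>. a \<le> \<tau> \<Longrightarrow> \<tau> \<le> b \<Longrightarrow> 0 < \<rho> \<Longrightarrow> S \<tau> = of_real \<rho> * cis \<theta> \<Longrightarrow> 0 \<le> \<theta> \<Longrightarrow> \<theta> < 2 * pi
           \<Longrightarrow> \<theta> \<in> arc_set \<alpha> \<phi>"
proof -
  define u where "u = norm (S a)"
  define z where "z = (\<lambda>\<tau>. S \<tau> / S a)"
  \<comment> \<open>Polar angle relative to \<open>S a\<close>; the arctangent is valid since
    \<open>z\<close> stays close to 1.\<close>
  define h where "h = (\<lambda>\<tau>. arctan (Im (z \<tau>) / Re (z \<tau>)))"
  have u: "0 < u" using p by (simp add: u_def)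
  have z1: "norm (z \<tau> - 1) \<le> 1 / 10 ^ 5" if "a \<le> \<tau>" "\<tau> \<le> b" for \<tau>
  proof -
    have "z \<tau> - 1 = (S \<tau> - S a) / S a" using p by (simp add: z_def field_simps)
    then have "norm (z \<tau> - 1) = norm (S \<tau> - S a) / u" by (simp add: norm_divide u_def)
    then show ?thesis using near[OF that] u by (simp add: u_def divide_le_eq)
  qed
  have Re: "1 - 1 / 10 ^ 5 \<le> Re (z \<tau>)" and Im: "\<bar>Im (z \<tau>)\<bar> \<le> 1 / 10 ^ 5" if "a \<le> \<tau>" "\<tau> \<le> b" for \<tau>
    using z1[OF that] abs_Re_le_cmod[of "z \<tau> - 1"] abs_Im_le_cmod[of "z \<tau> - 1"] by auto
  have h_small: "\<bar>h \<tau>\<bar> \<le> 1 / 200" if "a \<le> \<tau>" "\<tau> \<le> b" for \<tau>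
  proof -
    have "\<bar>h \<tau>\<bar> \<le> \<bar>Im (z \<tau>) / Re (z \<tau>)\<bar>"
      unfolding h_def by (rule abs_arctan_le)
    also have "\<dots> \<le> (1 / 10 ^ 5) / (1 - 1 / 10 ^ 5)"
      unfolding abs_divide using Re[OF that] Im[OF that] by (intro frac_le) auto
    finally show ?thesis by simp
  qed
  have polar: "S \<tau> = S a * (of_real (norm (z \<tau>)) * cis (h \<tau>))" if "a \<le> \<tau>" "\<tau> \<le> b" for \<tau>
  proof -
    have "0 < Re (z \<tau>)" using Re[OF that] by simp
    then have "h \<tau> = Arg (z \<tau>)" by (simp add: h_def arg_conv_arctan)
    then have "z \<tau> = of_real (norm (z \<tau>)) * cis (h \<tau>)"
      using rcis_cmod_Arg[of "z \<tau>"] by (simp add: rcis_def)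
    moreover have "S \<tau> = S a * z \<tau>" using p by (simp add: z_def)
    ultimately show ?thesis by simp
  qed
  have normS: "norm (S \<tau>) = u * norm (z \<tau>)" for \<tau>
    using p by (simp add: z_def u_def norm_divide)
  have "continuous_on {a..b} h"
    unfolding h_def z_def
  proof (intro continuous_intros cont)
    show "\<forall>\<tau>\<in>{a..b}. Re (S \<tau> / S a) \<noteq> 0"
      using Re unfolding z_def by (force simp del: Re_divide)
  qed (use p in auto)
  then obtain m n where m: "m \<in> {a..b}" "\<And>\<tau>. \<tau> \<in> {a..b} \<Longrightarrow> h m \<le> h \<tau>"
    and n: "n \<in> {a..b}" "\<And>\<tau>. \<tau> \<in> {a..b} \<Longrightarrow> h \<tau> \<le> h n"
    using ab continuous_attains_inf[of "{a..b}" h] continuous_attains_sup[of "{a..b}" h] by auto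
  define \<phi> where "\<phi> = h n - h m"
  define \<alpha> where "\<alpha> = Arg2pi (S m)"
  \<comment> \<open>The two extremes in their order of time.\<close>
  define x where "x = min m n"
  define y where "y = max m n"
  have \<phi>: "0 \<le> \<phi>" "\<phi> \<le> 1 / 100"
    using m(2)[OF n(1)] h_small[of m] h_small[of n] m(1) n(1) by (auto simp: \<phi>_def)
  have \<alpha>: "0 \<le> \<alpha>" "\<alpha> < 2 * pi" by (simp_all add: \<alpha>_def Arg2pi_ge_0 Arg2pi_lt_2pi)
  have nz: "1 - 1 / 10 ^ 5 \<le> norm (z \<tau>)" if "\<tau> \<in> {a..b}" for \<tau>
    using Re[of \<tau>] complex_Re_le_cmod[of "z \<tau>"] that by auto
  \<comment> \<open>Tangential part of the chord from \<open>S x\<close> to \<open>S y\<close>, by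
    \<open>dist_polar_sq\<close>.\<close>
  define \<sigma> where "\<sigma> = 2 * u * sqrt (norm (z x) * norm (z y)) * sin (\<phi> / 2)"
  have xy: "a \<le> x" "x \<le> y" "y \<le> b" "x \<in> {a..b}" "y \<in> {a..b}" using m n by (auto simp: x_def y_def)
  have s0: "0 \<le> sin (\<phi> / 2)" using \<phi> pi_gt3 by (intro sin_ge_zero) auto
  have \<sigma>0: "0 \<le> \<sigma>" using u s0 by (simp add: \<sigma>_def)
  have "(norm (S y - S x))\<^sup>2 = (norm (S y) - norm (S x))\<^sup>2 + \<sigma>\<^sup>2"
  proof -
    have "S y - S x = S a * (of_real (norm (z y)) * cis (h y) - of_real (norm (z x)) * cis (h x))"
      using polar[of x] polar[of y] xy by (simp add: algebra_simps)
    then have "(norm (S y - S x))\<^sup>2 = u\<^sup>2 * ((norm (z y) - norm (z x))\<^sup>2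
        + 4 * norm (z y) * norm (z x) * (sin ((h y - h x) / 2))\<^sup>2)"
      by (simp add: norm_mult power_mult_distrib dist_polar_sq u_def)
    also have "(sin ((h y - h x) / 2))\<^sup>2 = (sin (\<phi> / 2))\<^sup>2"
    proof -
      have "h y - h x = \<phi> \<or> h y - h x = - \<phi>" by (auto simp: x_def y_def \<phi>_def min_def max_def)
      then show ?thesis by (elim disjE) simp_all
    qed
    also have "u\<^sup>2 * ((norm (z y) - norm (z x))\<^sup>2 + 4 * norm (z y) * norm (z x) * (sin (\<phi> / 2))\<^sup>2)
        = (u * norm (z y) - u * norm (z x))\<^sup>2 + 4 * u\<^sup>2 * (norm (z x) * norm (z y)) * (sin (\<phi> / 2))\<^sup>2"
      by algebra
    also have "4 * u\<^sup>2 * (norm (z x) * norm (z y)) * (sin (\<phi> / 2))\<^sup>2 = \<sigma>\<^sup>2"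
      by (simp add: \<sigma>_def power_mult_distrib)
    finally show ?thesis by (simp only: normS)
  qed
  then have len: "\<sigma>\<^sup>2 + (norm (S b) - norm (S a))\<^sup>2
      \<le> (norm (S x - S a) + norm (S y - S x) + norm (S b - S y))\<^sup>2"
    using \<sigma>0 by (rule polar_length_bound)
  \<comment> \<open>The relative losses \<open>1 / 10 ^ 5\<close> in the radii and
    \<open>1 / 10 ^ 4\<close> in the sine fit into the factor 1.0004.\<close>
  have "u * \<phi> / 1.0004 \<le> \<sigma>"
  proof -
    have "1 - 1 / 10 ^ 5 \<le> sqrt (norm (z x) * norm (z y))"
      using mult_mono[OF nz[OF xy(4)] nz[OF xy(5)]]
      by (intro real_le_rsqrt) (simp add: power2_eq_square)
    then have "u * ((1 - 1 / 10 ^ 5) * (\<phi> * (1 - 1 / 10 ^ 4)))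
        \<le> u * (sqrt (norm (z x) * norm (z y)) * (2 * sin (\<phi> / 2)))"
      using \<phi> u by (intro mult_left_mono mult_mono[OF _ sin_half_lower[OF \<phi>]]) auto
    moreover have "u * \<phi> / 1.0004 \<le> u * ((1 - 1 / 10 ^ 5) * (\<phi> * (1 - 1 / 10 ^ 4)))"
    proof -
      have "(u * \<phi>) * (1 / 1.0004) \<le> (u * \<phi>) * ((1 - 1 / 10 ^ 5) * (1 - 1 / 10 ^ 4))"
        using u \<phi> by (intro mult_left_mono) auto
      then show ?thesis by (simp add: mult_ac)
    qed
    ultimately show ?thesis by (simp add: \<sigma>_def mult_ac)
  qed
  then have "(u * \<phi> / 1.0004)\<^sup>2 \<le> \<sigma>\<^sup>2" using u \<phi> by (intro power_mono) auto
  with len have len': "(norm (S a) * \<phi> / 1.0004)\<^sup>2 + (norm (S b) - norm (S a))\<^sup>2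
      \<le> (norm (S x - S a) + norm (S y - S x) + norm (S b - S y))\<^sup>2"
    by (simp add: u_def)
  have dir: "\<theta> \<in> arc_set \<alpha> \<phi>"
    if \<tau>: "a \<le> \<tau>" "\<tau> \<le> b" and \<rho>: "0 < \<rho>" "S \<tau> = of_real \<rho> * cis \<theta>" and \<theta>: "0 \<le> \<theta>" "\<theta> < 2 * pi" for \<tau> \<rho> \<theta>
  proof -
    have sg: "sgn (S t) = sgn (S a) * cis (h t)" if "t \<in> {a..b}" for t
    proof -
      have "0 < norm (z t)" using nz[OF that] by (rule less_le_trans[rotated]) simp
      have "sgn (S t) = sgn (S a) * (sgn (of_real (norm (z t))) * sgn (cis (h t)))"
        using polar[of t] that by (metis atLeastAtMost_iff sgn_mult)
      also have "sgn (complex_of_real (norm (z t))) = 1"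
        using \<open>0 < norm (z t)\<close> by (simp add: sgn_eq)
      finally show ?thesis by simp
    qed
    have "cis \<theta> = sgn (S \<tau>)" using \<rho> by (simp add: sgn_mult sgn_eq norm_mult)
    also have "\<dots> = sgn (S m) * cis (h \<tau> - h m)"
      using sg[of \<tau>] sg[OF m(1)] \<tau> by (simp add: cis_mult)
    also have "sgn (S m) = cis \<alpha>"
    proof -
      have "S m \<noteq> 0" using normS[of m] nz[OF m(1)] u by force
      then show ?thesis
        using Arg2pi[of "S m"] by (simp add: \<alpha>_def is_Arg_def sgn_eq cis_conv_exp field_simps)
    qed
    finally have "cis (\<alpha> + (h \<tau> - h m)) = cis \<theta>" by (simp add: cis_mult)
    then show ?thesis
      using m(2)[of \<tau>] n(2)[of \<tau>] \<tau> \<alpha> \<phi> pi_gt3 \<theta>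
      by (intro cis_in_arc_set[where t = "\<alpha> + (h \<tau> - h m)"]) (auto simp: \<phi>_def)
  qed
  show thesis by (rule that[OF \<alpha> \<phi>(1) xy(1-3) len' dir])
qed

section \<open>Accumulated weight of a competitive strategy\<close>

lemma escape_attains_norm:
  assumes "escape_strategy S s" "0 < R"
  obtains t where "0 \<le> t" "norm (S t) = R"
proof -
  obtain P where P: "environment P" "s \<in> interior P"
    and fr: "frontier P = (\<lambda>e. s + of_real R * e) ` sphere 0 1"
    using star_environment[of "\<lambda>_. R" s] assms(2) by auto
  obtain t where "0 \<le> t" "s + S t \<in> frontier P"
    using assms(1) P unfolding escape_strategy_def by blast
  then show thesis using assms(2) that[of t] unfolding fr by (auto simp: norm_mult)
qed

text \<open>The accounting starts at this time: from then on the record distance is at least 1,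
  which makes absolute errors small relative to it.\<close>

lemma escape_first_unit_time:
  assumes "escape_strategy S s"
  obtains t where "0 \<le> t" "norm (S t) = 1" "\<And>\<tau>. 0 \<le> \<tau> \<Longrightarrow> \<tau> \<le> t \<Longrightarrow> norm (S \<tau>) \<le> 1"
proof -
  obtain T where T: "0 \<le> T" "norm (S T) = 1" using escape_attains_norm[OF assms, of 1] by auto
  have cont: "continuous_on {0..b} S" for b
    using assms continuous_on_subset unfolding escape_strategy_def by fastforce
  define A where "A = {t \<in> {0..T}. norm (S t) = 1}"
  have "closed A" unfolding A_def
    by (intro continuous_closed_preimage_constant continuous_intros cont)
  moreover have "A \<subseteq> {0..T}" by (auto simp: A_def)
  ultimately have "compact A" by (metis compact_Icc compact_Int_closed inf.absorb_iff2)
  moreover have "A \<noteq> {}" using T by (auto simp: A_def)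
  ultimately obtain t where t: "t \<in> A" "\<And>\<tau>. \<tau> \<in> A \<Longrightarrow> t \<le> \<tau>"
    using compact_attains_inf by metis
  have "norm (S \<tau>) \<le> 1" if \<tau>: "0 \<le> \<tau>" "\<tau> \<le> t" for \<tau>
  proof (rule ccontr)
    assume "\<not> norm (S \<tau>) \<le> 1"
    moreover have "norm (S 0) \<le> 1" using assms by (simp add: escape_strategy_def)
    ultimately obtain x where x: "0 \<le> x" "x \<le> \<tau>" "norm (S x) = 1"
      using IVT'[of "\<lambda>x. norm (S x)" 0 1 \<tau>] \<tau>(1) continuous_on_norm[OF cont[of \<tau>]] by auto
    then have "x \<in> A" using \<tau> t(1) by (auto simp: A_def)
    then have "x = \<tau>" using t(2)[of x] x \<tau> by auto
    then show False using x \<open>\<not> norm (S \<tau>) \<le> 1\<close> by simp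
  qed
  then show thesis using that[of t] t(1) by (auto simp: A_def)
qed

text \<open>On [a, b] the path has length at least e, of which tau is tangential, and the set B of angles
  contains the directions it visits. A piece that starts within distance 1/25 of the origin will get
  weight 0, so nothing is required of its directions.\<close>

definition piece :: "(real \<Rightarrow> complex) \<Rightarrow> real \<Rightarrow> real \<Rightarrow> real \<Rightarrow> real \<Rightarrow> real set \<Rightarrow> bool" where
  "piece S a b e \<tau> B \<longleftrightarrow> 0 \<le> e \<and> e \<le> 3 / 10 ^ 7 \<and> 0 \<le> \<tau> \<and>
     \<tau>\<^sup>2 + (norm (S b) - norm (S a))\<^sup>2 \<le> e\<^sup>2 \<and>
     (\<forall>l. ereal l \<le> curve_length S 0 a \<longrightarrow> ereal (l + e) \<le> curve_length S 0 b) \<and>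
     B \<in> sets borel \<and> emeasure lborel B < \<infinity> \<and>
     (1 / 25 \<le> norm (S a) \<longrightarrow> measure lborel B \<le> 1.0004 * \<tau> / norm (S a) \<and>
       (\<forall>x \<rho> \<theta>. a \<le> x \<longrightarrow> x \<le> b \<longrightarrow> 0 < \<rho> \<longrightarrow> S x = of_real \<rho> * cis \<theta> \<longrightarrow> 0 \<le> \<theta> \<longrightarrow> \<theta> < 2 * pi
          \<longrightarrow> \<theta> \<in> B))"

text \<open>The threshold \<open>1 / 25\<close> ensures that a displacement of
  \<open>1 / 10 ^ 7\<close> is below \<open>norm (S a) / 10 ^ 5\<close>, as
  \<open>piece_geometry\<close> requires.\<close>

lemma piece_exists:
  fixes S :: "real \<Rightarrow> complex"
  assumes ab: "0 \<le> a" "a \<le> b" and cont: "continuous_on {a..b} S"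
    and near: "\<And>x y. x \<in> {a..b} \<Longrightarrow> y \<in> {a..b} \<Longrightarrow> norm (S x - S y) \<le> 1 / 10 ^ 7"
  shows "\<exists>e \<tau> B. piece S a b e \<tau> B"
proof (cases "1 / 25 \<le> norm (S a)")
  case False
  have "\<bar>norm (S b) - norm (S a)\<bar>\<^sup>2 \<le> (norm (S b - S a))\<^sup>2"
    by (intro power_mono norm_triangle_ineq3) auto
  moreover have "ereal (l + norm (S b - S a)) \<le> curve_length S 0 b" if "ereal l \<le> curve_length S 0 a" for l
    using curve_length_extend[OF that ab] by (simp add: dist_norm norm_minus_commute)
  \<comment> \<open>Near the origin the chord alone serves, with no tangential part and no
    directions.\<close>
  ultimately have "piece S a b (norm (S b - S a)) 0 {}"
    using False near[of b a] ab unfolding piece_def by auto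
  then show ?thesis by blast
next
  case True
  obtain \<alpha> \<phi> x y where \<alpha>: "0 \<le> \<alpha>" "\<alpha> < 2 * pi" "0 \<le> \<phi>" and xy: "a \<le> x" "x \<le> y" "y \<le> b"
    and len: "(norm (S a) * \<phi> / 1.0004)\<^sup>2 + (norm (S b) - norm (S a))\<^sup>2
           \<le> (norm (S x - S a) + norm (S y - S x) + norm (S b - S y))\<^sup>2"
    and dir: "\<And>\<tau> \<rho> \<theta>. a \<le> \<tau> \<Longrightarrow> \<tau> \<le> b \<Longrightarrow> 0 < \<rho> \<Longrightarrow> S \<tau> = of_real \<rho> * cis \<theta> \<Longrightarrow> 0 \<le> \<theta> \<Longrightarrow> \<theta> < 2 * pi
           \<Longrightarrow> \<theta> \<in> arc_set \<alpha> \<phi>"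
  proof (rule piece_geometry[OF ab(2) cont])
    show "S a \<noteq> 0" using True by auto
    show "norm (S \<tau> - S a) \<le> norm (S a) / 10 ^ 5" if "a \<le> \<tau>" "\<tau> \<le> b" for \<tau>
      using near[of \<tau> a] that True by auto
  qed blast
  define e where "e = norm (S x - S a) + norm (S y - S x) + norm (S b - S y)"
  have "ereal (l + e) \<le> curve_length S 0 b" if "ereal l \<le> curve_length S 0 a" for l
  proof -
    have "ereal (l + dist (S a) (S x)) \<le> curve_length S 0 x"
      using ab xy by (intro curve_length_extend[OF that]) auto
    from curve_length_extend[OF this, of y]
    have "ereal (l + dist (S a) (S x) + dist (S x) (S y)) \<le> curve_length S 0 y"
      using ab xy by simp
    from curve_length_extend[OF this, of b]
    have "ereal (l + dist (S a) (S x) + dist (S x) (S y) + dist (S y) (S b)) \<le> curve_length S 0 b"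
      using ab xy by simp
    then show ?thesis by (simp add: e_def dist_norm norm_minus_commute add.assoc)
  qed
  moreover have "e \<le> 3 / 10 ^ 7"
    using near[of x a] near[of y x] near[of b y] xy ab unfolding e_def by auto
  moreover have "measure lborel (arc_set \<alpha> \<phi>) \<le> 1.0004 * (norm (S a) * \<phi> / 1.0004) / norm (S a)"
  proof -
    have "norm (S a) \<noteq> 0" using True by auto
    then show ?thesis using measure_arc_set[OF \<alpha>] by simp
  qed
  moreover have "0 \<le> norm (S a) * \<phi> / 1.0004" using \<alpha>(3) by simp
  moreover have "0 \<le> e" by (simp add: e_def)
  ultimately have "piece S a b e (norm (S a) * \<phi> / 1.0004) (arc_set \<alpha> \<phi>)"
    using len dir emeasure_arc_set_finite[of \<alpha> \<phi>] arc_set_sets[of \<alpha> \<phi>]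
    unfolding piece_def e_def by blast
  then show ?thesis by blast
qed

section \<open>Summation over a fine partition of the path\<close>

lemma partition_cell:
  fixes t :: "nat \<Rightarrow> real"
  assumes "t 0 < x" "x \<le> t k"
  obtains i where "i < k" "t i \<le> x" "x \<le> t (Suc i)"
proof -
  have "\<exists>i<k. t i \<le> x \<and> x \<le> t (Suc i)"
    using assms
  proof (induction k)
    case (Suc k)
    show ?case
    proof (cases "x \<le> t k")
      case True
      then show ?thesis using Suc by (meson less_SucI)
    next
      case False
      then show ?thesis using Suc.prems by (intro exI[of _ k]) auto
    qed
  qed simp
  then show thesis using that by blast
qed

lemma not_competitive:
  assumes comp: "competitive S s 3.313126"
  shows False
proof -
  have esc: "escape_strategy S s" using comp by (simp add: competitive_def)
  have cont: "continuous_on {0..} S" and S0: "S 0 = 0" using esc by (auto simp: escape_strategy_def)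
  obtain t0 where t0: "0 \<le> t0" "norm (S t0) = 1" "\<And>\<tau>. 0 \<le> \<tau> \<Longrightarrow> \<tau> \<le> t0 \<Longrightarrow> norm (S \<tau>) \<le> 1"
    using escape_first_unit_time[OF esc] by blast
  \<comment> \<open>The exponent 100000 is large enough for the final numerical contradiction, since
    \<open>2 * pi - 6.28\<close> exceeds 0.003.\<close>
  obtain T where T: "0 \<le> T" "norm (S T) = exp 100000"
    using escape_attains_norm[OF esc, of "exp 100000"] by auto
  have "t0 < T"
  proof (rule ccontr)
    assume "\<not> t0 < T"
    then have "exp 100000 \<le> (1::real)" using t0(3)[of T] T by simp
    then show False by simp
  qed
  have "uniformly_continuous_on {0..T} S"
    using cont by (intro compact_uniformly_continuous continuous_on_subset[OF cont]) auto
  then obtain \<delta> where \<delta>: "0 < \<delta>"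
    "\<And>x y. x \<in> {0..T} \<Longrightarrow> y \<in> {0..T} \<Longrightarrow> dist y x < \<delta> \<Longrightarrow> dist (S y) (S x) < 1 / 10 ^ 7"
    unfolding uniformly_continuous_on_def by (metis zero_less_divide_1_iff zero_less_numeral zero_less_power)
  obtain N :: nat where N: "(T - t0) / \<delta> < real N" using reals_Archimedean2 by blast
  have "0 < (T - t0) / \<delta>" using \<delta> \<open>t0 < T\<close> by simp
  then have N0: "0 < real N" using N by linarith
  define h where "h = (T - t0) / real N"
  have h: "0 < h" "h < \<delta>" using N N0 \<delta> \<open>t0 < T\<close> by (auto simp: h_def field_simps)
  define t where "t = (\<lambda>i::nat. t0 + real i * h)"
  have t_0: "t 0 = t0" and t_N: "t N = T" using N0 by (auto simp: t_def h_def)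
  have t_mono: "t i \<le> t j" if "i \<le> j" for i j using that h by (simp add: t_def mult_right_mono)
  have t_ge: "0 \<le> t i" "t0 \<le> t i" for i using t_mono[of 0 i] t0(1) t_0 by auto
  have near: "norm (S x - S y) \<le> 1 / 10 ^ 7"
    if "i < N" "x \<in> {t i..t (Suc i)}" "y \<in> {t i..t (Suc i)}" for i x y
  proof -
    have "t (Suc i) \<le> T" using t_mono[of "Suc i" N] that(1) t_N by simp
    moreover have "dist x y \<le> h" using that by (auto simp: t_def dist_real_def algebra_simps)
    ultimately have "dist (S x) (S y) < 1 / 10 ^ 7"
      using that t_ge(1)[of i] h by (intro \<delta>(2)) auto
    then show ?thesis by (simp add: dist_norm)
  qed
  have "\<exists>e \<tau> B. piece S (t i) (t (Suc i)) e \<tau> B" if "i < N" for i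
  proof (rule piece_exists)
    show "continuous_on {t i..t (Suc i)} S"
      using t_ge(1)[of i] by (intro continuous_on_subset[OF cont]) auto
  qed (use t_ge t_mono near that in auto)
  then obtain e \<tau> B where pc: "\<And>i. i < N \<Longrightarrow> piece S (t i) (t (Suc i)) (e i) (\<tau> i) (B i)"
    by metis
  define u where "u = (\<lambda>i. norm (S (t i)))"
  \<comment> \<open>A lower bound for the path length; it starts at 1 because the path has reached
    distance 1 at time \<open>t0\<close>.\<close>
  define l where "l = (\<lambda>i. 1 + (\<Sum>j<i. e j))"
  define M where "M = (\<lambda>i. Max (u ` {..i}))"
  \<comment> \<open>The exact factor of \<open>competitive_ray\<close>; \<open>full_turn\<close> is
    its slightly larger substitute.\<close>
  define k :: real where "k = 3.313126 * (1 + 2 * pi)"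
  have k: "24 < k" "k * (1 + 2 / 10 ^ 7) < 25" "k * (1 / 25 + 2 / 10 ^ 7) < 1"
    using pi_approx by (auto simp: k_def)
  have e: "0 \<le> e i" "e i \<le> 3 / 10 ^ 7" "0 \<le> \<tau> i" "(\<tau> i)\<^sup>2 + (u (Suc i) - u i)\<^sup>2 \<le> (e i)\<^sup>2"
    if "i < N" for i using pc[OF that] by (auto simp: piece_def u_def)
  have dir: "\<theta> \<in> B i"
    if "i < N" "1 / 25 \<le> u i" "t i \<le> x" "x \<le> t (Suc i)" "0 < \<rho>" "S x = of_real \<rho> * cis \<theta>"
      "0 \<le> \<theta>" "\<theta> < 2 * pi" for i x \<rho> \<theta>
    using pc[OF that(1)] that(2-) unfolding piece_def u_def by blast
  have l_Suc: "l (Suc i) = l i + e i" for i by (simp add: l_def)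
  have l_0: "l 0 = 1" by (simp add: l_def)
  have u_0: "u 0 = 1" using t0(2) t_0 by (simp add: u_def)
  have u0: "0 \<le> u i" for i by (simp add: u_def)
  have M_Suc: "M (Suc i) = max (M i) (u (Suc i))" for i
    by (simp add: M_def atMost_Suc max.commute)
  have M_0: "M 0 = 1" by (simp add: M_def u_0)
  have u_le_M: "u j \<le> M i" if "j \<le> i" for i j using that by (simp add: M_def)
  have M1: "1 \<le> M i" for i using u_le_M[of 0 i] u_0 by simp
  have du: "\<bar>u (Suc i) - u i\<bar> \<le> e i" if "i < N" for i
  proof -
    have "(u (Suc i) - u i)\<^sup>2 \<le> (e i)\<^sup>2" using e(4)[OF that] zero_le_power2[of "\<tau> i"] by linarith
    then show ?thesis using e(1)[OF that] by (simp add: abs_le_square_iff[symmetric])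
  qed
  have ul: "u i \<le> l i" if "i \<le> N" for i
    using that
  proof (induction i)
    case (Suc i)
    then show ?case using du[of i] l_Suc[of i] by simp
  qed (simp add: u_0 l_0)
  have l_mono: "l i \<le> l j" if "i \<le> j" "j \<le> N" for i j
    using that e(1) unfolding l_def by (intro add_left_mono sum_mono2) auto
  have l1: "1 \<le> l i" if "i \<le> N" for i using l_mono[of 0 i] l_0 that by simp
  have Ml: "M i \<le> l i" if "i \<le> N" for i
  proof -
    have "u j \<le> l i" if "j \<le> i" for j
      using ul[of j] l_mono[of j i] that \<open>i \<le> N\<close> by simp
    then show ?thesis by (auto simp: M_def)
  qed
  have len: "ereal (l i) \<le> curve_length S 0 (t i)" if "i \<le> N" for i
    using that
  proof (induction i)
    case 0
    have "ereal (0 + dist (S 0) (S t0)) \<le> curve_length S 0 t0"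
      using curve_length_nonneg[of S 0 0] t0(1) by (intro curve_length_extend) (auto simp: zero_ereal_def)
    then show ?case using S0 t0(2) by (simp add: l_0 t_0)
  next
    case (Suc i)
    then show ?case using pc[of i] by (simp add: piece_def l_Suc)
  qed
  have in_disc: "norm (S x) \<le> M i + 1 / 10 ^ 7" if x: "i \<le> N" "0 \<le> x" "x \<le> t i" for i x
  proof (cases "x \<le> t 0")
    case True
    then show ?thesis using t0(3)[of x] x(2) t_0 M1[of i] by simp
  next
    case False
    then obtain j where j: "j < i" "t j \<le> x" "x \<le> t (Suc j)"
      using partition_cell[of t x i] x(3) by auto
    have "norm (S x - S (t j)) \<le> 1 / 10 ^ 7" using near[of j x "t j"] j x(1) by auto
    moreover have "norm (S x) \<le> norm (S x - S (t j)) + u j"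
      using norm_triangle_sub[of "S x" "S (t j)"] by (simp add: u_def add.commute)
    ultimately show ?thesis using u_le_M[of j i] j(1) by simp
  qed
  have lM: "l i \<le> 3.3132 * M i" if "i \<le> N" for i
  proof -
    have "curve_length S 0 (t i) \<le> ereal (3.313126 * (M i + 2 / 10 ^ 7))"
    proof (rule competitive_disc[OF comp t_ge(1)])
      show "norm (S x) < M i + 2 / 10 ^ 7" if "0 \<le> x" "x \<le> t i" for x
        using in_disc[OF \<open>i \<le> N\<close> that] by simp
    qed (use M1[of i] in auto)
    with len[OF that] have "l i \<le> 3.313126 * (M i + 2 / 10 ^ 7)"
      by (metis ereal_less_eq(3) order_trans)
    then show ?thesis using M1[of i] by simp
  qed
  \<comment> \<open>One \<open>1 / 10 ^ 7\<close> of the slack covers the displacement within a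
    cell, the other the shift in the depth \<open>x\<close> used in the covering argument.\<close>
  define w where "w = (\<lambda>i. max 0 (ln (k * (u i + 2 / 10 ^ 7) / l i)))"
  have w0: "0 \<le> w i" for i by (simp add: w_def)
  have w_far: "w i = 0" if "u i < 1 / 25" "i \<le> N" for i
  proof -
    have "k * (u i + 2 / 10 ^ 7) \<le> k * (1 / 25 + 2 / 10 ^ 7)" using that k by (intro mult_left_mono) auto
    then have "k * (u i + 2 / 10 ^ 7) / l i \<le> 1" using k(3) l1[OF that(2)] by simp
    moreover have "0 < k * (u i + 2 / 10 ^ 7) / l i" using k(1) u0[of i] l1[OF that(2)]
      by (intro divide_pos_pos mult_pos_pos) auto
    ultimately show ?thesis by (simp add: w_def)
  qed
  \<comment> \<open>Strong induction: some visit to the direction before \<open>t j\<close>, in cell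
    \<open>i\<close>, has weight at least \<open>ln (l j / l i)\<close>, and the induction
    hypothesis covers \<open>ln (l i / 25)\<close>.\<close>
  have cover: "ln (l N / 25) \<le> (\<Sum>i\<in>{i \<in> {..<N}. \<theta> \<in> B i}. w i)"
    if \<theta>: "0 \<le> \<theta>" "\<theta> < 2 * pi" for \<theta>
  proof -
    have "ln (l j / 25) \<le> (\<Sum>i\<in>{i \<in> {..<j}. \<theta> \<in> B i}. w i)" if "j \<le> N" for j
      using that
    proof (induction j rule: less_induct)
      case (less j)
      \<comment> \<open>The shift by \<open>1 / 10 ^ 7\<close> makes \<open>k * x\<close> strictly
        smaller than \<open>l j\<close>, so that an unvisited direction contradicts
        \<open>competitive_ray\<close>.\<close>
      define x where "x = l j / k - 1 / 10 ^ 7"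
      have lj: "1 \<le> l j" using l1 less.prems by simp
      show ?case
      proof (cases "x \<le> 1")
        case True
        then have "l j \<le> k * (1 + 1 / 10 ^ 7)" using k(1) by (simp add: x_def field_simps)
        then have "l j \<le> 25" using k by simp
        then have "ln (l j / 25) \<le> 0" using lj by simp
        also have "0 \<le> (\<Sum>i\<in>{i \<in> {..<j}. \<theta> \<in> B i}. w i)" using w0 by (intro sum_nonneg) auto
        finally show ?thesis .
      next
        case False
        have "\<exists>y \<rho>. 0 \<le> y \<and> y \<le> t j \<and> x \<le> \<rho> \<and> S y = of_real \<rho> * cis \<theta>"
        proof (rule ccontr)
          assume "\<not> ?thesis"
          then have "curve_length S 0 (t j) \<le> ereal (3.313126 * (x * (1 + 2 * pi)))"
            using False t_ge(1) by (intro competitive_ray[OF comp, where d = "cis \<theta>"]) auto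
          with len[OF less.prems] have "l j \<le> 3.313126 * (x * (1 + 2 * pi))"
            by (metis ereal_less_eq(3) order_trans)
          also have "\<dots> = k * x" by (simp add: k_def)
          also have "\<dots> < l j" using k(1) by (simp add: x_def algebra_simps)
          finally show False by simp
        qed
        then obtain y \<rho> where y: "0 \<le> y" "y \<le> t j" "x \<le> \<rho>" "S y = of_real \<rho> * cis \<theta>" by blast
        then have ny: "norm (S y) = \<rho>" "1 < \<rho>" using False by (auto simp: norm_mult)
        \<comment> \<open>Up to \<open>t0\<close> the path stays in the closed unit disc, so a visit
          deeper than 1 falls into a cell of the partition.\<close>
        then have "t 0 < y" using t0(3)[of y] y(1) t_0 by force
        then obtain i where i: "i < j" "t i \<le> y" "y \<le> t (Suc i)"
          using partition_cell[of t y j] y(2) by auto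
        have iN: "i < N" using i(1) less.prems by simp
        have "norm (S y - S (t i)) \<le> 1 / 10 ^ 7" using near[OF iN, of y "t i"] i by auto
        then have \<rho>u: "\<rho> \<le> u i + 1 / 10 ^ 7"
          using ny norm_triangle_sub[of "S y" "S (t i)"] by (simp add: u_def)
        then have "1 / 25 \<le> u i" using ny by simp
        moreover have "0 < \<rho>" using ny(2) by simp
        ultimately have \<theta>B: "\<theta> \<in> B i"
          using dir[OF iN _ i(2,3) _ y(4) \<theta>] by blast
        have li: "1 \<le> l i" using l1 iN by simp
        have "l j / k \<le> u i + 2 / 10 ^ 7" using y(3) \<rho>u by (simp add: x_def)
        then have "l j \<le> k * (u i + 2 / 10 ^ 7)" using k(1) by (simp add: field_simps)
        then have "ln (l j / l i) \<le> ln (k * (u i + 2 / 10 ^ 7) / l i)"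
          using lj li by (subst ln_le_cancel_iff) (auto simp: divide_right_mono intro!: divide_pos_pos)
        then have 1: "ln (l j / l i) \<le> w i" by (simp add: w_def)
        have "ln (l j / 25) = ln (l i / 25) + ln (l j / l i)"
          using lj li by (simp add: ln_div)
        also have "\<dots> \<le> (\<Sum>m\<in>{m \<in> {..<i}. \<theta> \<in> B m}. w m) + w i"
          using less.IH[OF i(1)] iN 1 by simp
        also have "\<dots> = (\<Sum>m\<in>insert i {m \<in> {..<i}. \<theta> \<in> B m}. w m)" by simp
        also have "\<dots> \<le> (\<Sum>i\<in>{i \<in> {..<j}. \<theta> \<in> B i}. w i)"
          using i(1) \<theta>B w0 by (intro sum_mono2) auto
        finally show ?thesis .
      qed
    qed
    then show ?thesis by simp
  qed
  define q where "q = (\<lambda>i. w i * measure lborel (B i))"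
  have lower: "2 * pi * ln (l N / 25) \<le> (\<Sum>i<N. q i)"
    unfolding q_def using cover w0 pc by (intro covering_weight) (auto simp: piece_def)
  have q: "q i \<le> 1.0004 * max 0 (ln (full_turn * u i / l i)) / u i * \<tau> i" if i: "i < N" for i
  proof (cases "1 / 25 \<le> u i")
    case False
    then show ?thesis using w_far[of i] i e(3)[OF i] u0[of i] by (simp add: q_def)
  next
    case True
    \<comment> \<open>Since \<open>u i\<close> is at least \<open>1 / 25\<close>, replacing 3.313126
      by 3.3132 absorbs the additive slack.\<close>
    have "k * (u i + 2 / 10 ^ 7) \<le> full_turn * u i"
    proof -
      have "3.313126 * (u i + 2 / 10 ^ 7) * (1 + 2 * pi) \<le> 3.3132 * u i * (1 + 2 * pi)"
        using True pi_gt_zero by (intro mult_right_mono) auto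
      then show ?thesis unfolding k_def full_turn_def by (simp only: mult_ac)
    qed
    then have "w i \<le> max 0 (ln (full_turn * u i / l i))"
      unfolding w_def using True k(1) l1[of i] i full_turn_pos
      by (intro max.mono order.refl ln_mono divide_right_mono divide_pos_pos mult_pos_pos) auto
    moreover have "measure lborel (B i) \<le> 1.0004 * \<tau> i / u i"
      using pc[OF i] True by (simp add: piece_def u_def)
    ultimately have "q i \<le> max 0 (ln (full_turn * u i / l i)) * (1.0004 * \<tau> i / u i)"
      unfolding q_def by (intro mult_mono) auto
    then show ?thesis by (simp add: mult_ac)
  qed
  define \<Psi> where "\<Psi> = (\<lambda>i. potential (u i) (M i) (l i))"
  have step: "q i \<le> 6.28 * (ln (l (Suc i)) - ln (l i)) + \<Psi> i - \<Psi> (Suc i)" if i: "i < N" for i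
  proof -
    have iN: "i \<le> N" using i by simp
    have li: "1 \<le> l i" "1 \<le> l (Suc i)" using l1[of i] l1[of "Suc i"] i by auto
    have ln: "ln ((l i + e i) / l i) = ln (l (Suc i)) - ln (l i)"
      using li by (simp add: ln_div l_Suc)
    have M0: "0 < M i" using M1[of i] by simp
    have e6: "e i \<le> 1 / 10 ^ 6" using e(2)[OF i] by simp
    show ?thesis
    proof (cases "u (Suc i) \<le> M i")
      case True
      then have "M (Suc i) = M i" by (simp add: M_Suc)
      then show ?thesis
        using potential_step_flat[OF li(1) M0 Ml[OF iN] lM[OF iN] u0 u_le_M[OF order.refl] e(1)[OF i] e6 e(4)[OF i] e(3)[OF i] q[OF i]]
        by (simp add: \<Psi>_def ln l_Suc)
    next
      case False
      then have "M (Suc i) = u (Suc i)" "M i \<le> u i + (u (Suc i) - u i)" by (simp_all add: M_Suc)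
      then show ?thesis
        using potential_step_record[OF li(1) M0 Ml[OF iN] lM[OF iN] u0 u_le_M[OF order.refl] _ e(1)[OF i] e6 e(4)[OF i] e(3)[OF i] q[OF i]]
        by (simp add: \<Psi>_def ln l_Suc)
    qed
  qed
  \<comment> \<open>Logarithm and potential both telescope.\<close>
  have "(\<Sum>i<n. q i) \<le> 6.28 * ln (l n) + \<Psi> 0 - \<Psi> n" if "n \<le> N" for n
    using that
  proof (induction n)
    case 0
    then show ?case by (simp add: l_0)
  next
    case (Suc n)
    then show ?case using step[of n] by (simp add: diff_divide_distrib)
  qed
  then have "(\<Sum>i<N. q i) \<le> 6.28 * ln (l N) + \<Psi> 0 - \<Psi> N" by simp
  moreover have "\<Psi> i \<le> 7" "- 7 \<le> \<Psi> i" if "i \<le> N" for i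
    unfolding \<Psi>_def using u0 u_le_M[of i i] M1[of i] Ml[OF that] lM[OF that]
    by (intro potential_bounds; simp)+
  ultimately have "2 * pi * ln (l N / 25) \<le> 6.28 * ln (l N) + 14"
    using lower by (smt (verit) le0 order.refl)
  moreover have "2 * pi * ln (l N / 25) = 2 * pi * ln (l N) - 2 * pi * ln 25"
    using l1[of N] by (simp add: ln_div right_diff_distrib)
  \<comment> \<open>A crude bound on the logarithm suffices, as only constants are affected.\<close>
  moreover have "2 * pi * ln 25 \<le> 2 * pi * 24"
    using ln_le_minus_one[of "25::real"] by (intro mult_left_mono) auto
  ultimately have "(2 * pi - 6.28) * ln (l N) \<le> 2 * pi * 24 + 14"
    unfolding left_diff_distrib by linarith
  moreover have "100000 \<le> ln (l N)"
  proof -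
    have "exp 100000 \<le> l N" using ul[of N] T(2) t_N by (simp add: u_def)
    then have "ln (exp 100000) \<le> ln (l N)" using l1[of N] by (subst ln_le_cancel_iff) auto
    then show ?thesis by simp
  qed
  then have "(2 * pi - 6.28) * 100000 \<le> (2 * pi - 6.28) * ln (l N)"
    using pi_approx by (intro mult_left_mono) auto
  ultimately show False using pi_approx by simp
qed

theorem theorem2:
  fixes S :: "real \<Rightarrow> complex" and s :: complex
  assumes "escape_strategy S s"
  shows "(SUP P \<in> {P. environment P \<and> s \<in> interior P}.
            curve_length (\<lambda>t. s + S t) 0 (first_hit S s P) / ereal (certificate_length P s))
         \<ge> ereal 3.313126"
proof (rule ccontr)
  assume "\<not> ?thesis"
  then have "competitive S s 3.313126"
    unfolding competitive_def not_le using assms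
    by (auto dest!: less_imp_le simp: SUP_le_iff)
  then show False by (rule not_competitive)
qed

end
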